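(* Let $\mathcal{A}$ be a hereditary abelian category. A full subcategory $\mathcal{N}\subseteq\mathcal{A}$ is a narrow subcategory if and only if $\mathcal{N}$ is a tilting nullity class in its wide closure $\operatorname{wide}\mathcal{N}$.
   Context: Hereditary means $\operatorname{Ext}^2_{\mathcal{A}}(-,-)=0$. Subcategories are full, nonempty and closed under isomorphisms. A subcategory $\mathcal{N}\subseteq\mathcal{A}$ is narrow if it is closed under extensions and cokernels. A subcategory is wide if it is closed under kernels, cokernels and extensions; $\operatorname{wide}\mathcal{N}$ is the intersection of all wide subcategories of $\mathcal{A}$ containing $\mathcal{N}$ (an abelian category). A nullity class in an abelian category $\mathcal{B}$ is a full subcategory closed under quotient objects (in $\mathcal{B}$) and extensions; it is tilting if for every $B\in\mathcal{B}$ there is a monomorphism $B\to T$ with $T$ in the class. *)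

theory Defs
  imports "HOL-Algebra.Group"
begin

(* Categories enriched over abelian groups.  The operations are total functions on the
   type of arrows; composition and addition are meaningful only on composable, respectively
   parallel, arrows.  g \<cdot> f means "g after f". *)
record ('o, 'm) ab_cat =
  Obj :: "'o set"
  Arr :: "'m set"
  Dom :: "'m \<Rightarrow> 'o"
  Cod :: "'m \<Rightarrow> 'o"
  Ident :: "'o \<Rightarrow> 'm"
  Comp :: "'m \<Rightarrow> 'm \<Rightarrow> 'm"  (infixl \<open>\<cdot>\<index>\<close> 70)
  Plus :: "'m \<Rightarrow> 'm \<Rightarrow> 'm"  (infixl \<open>\<oplus>\<index>\<close> 65)
  Zero :: "'o \<Rightarrow> 'o \<Rightarrow> 'm"

definition homs :: "('o, 'm, 'z) ab_cat_scheme \<Rightarrow> 'o \<Rightarrow> 'o \<Rightarrow> 'm set"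
  where "homs C X Y = {f \<in> Arr C. Dom C f = X \<and> Cod C f = Y}"

definition hom_group :: "('o, 'm, 'z) ab_cat_scheme \<Rightarrow> 'o \<Rightarrow> 'o \<Rightarrow> 'm monoid"
  where "hom_group C X Y = \<lparr>carrier = homs C X Y, mult = Plus C, one = Zero C X Y\<rparr>"

locale category =
  fixes C :: "('o, 'm, 'z) ab_cat_scheme" (structure)
  assumes Dom_closed: "f \<in> Arr C \<Longrightarrow> Dom C f \<in> Obj C"
    and Cod_closed: "f \<in> Arr C \<Longrightarrow> Cod C f \<in> Obj C"
    and Ident_closed: "X \<in> Obj C \<Longrightarrow> Ident C X \<in> homs C X X"
    and Comp_closed: "f \<in> homs C X Y \<Longrightarrow> g \<in> homs C Y Z \<Longrightarrow> g \<cdot> f \<in> homs C X Z"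
    and Comp_Ident: "f \<in> homs C X Y \<Longrightarrow> f \<cdot> Ident C X = f"
    and Ident_Comp: "f \<in> homs C X Y \<Longrightarrow> Ident C Y \<cdot> f = f"
    and Comp_assoc: "f \<in> homs C W X \<Longrightarrow> g \<in> homs C X Y \<Longrightarrow> h \<in> homs C Y Z \<Longrightarrow>
          (h \<cdot> g) \<cdot> f = h \<cdot> (g \<cdot> f)"

locale preadditive_category = category +
  assumes hom_comm_group: "X \<in> Obj C \<Longrightarrow> Y \<in> Obj C \<Longrightarrow> comm_group (hom_group C X Y)"
    and Comp_Plus: "f \<in> homs C X Y \<Longrightarrow> f' \<in> homs C X Y \<Longrightarrow> g \<in> homs C Y Z \<Longrightarrow>
          g \<cdot> (f \<oplus> f') = (g \<cdot> f) \<oplus> (g \<cdot> f')"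
    and Plus_Comp: "f \<in> homs C X Y \<Longrightarrow> g \<in> homs C Y Z \<Longrightarrow> g' \<in> homs C Y Z \<Longrightarrow>
          (g \<oplus> g') \<cdot> f = (g \<cdot> f) \<oplus> (g' \<cdot> f)"

definition monic :: "('o, 'm, 'z) ab_cat_scheme \<Rightarrow> 'm \<Rightarrow> bool"
  where "monic C f \<longleftrightarrow> f \<in> Arr C \<and>
    (\<forall>W. \<forall>g \<in> homs C W (Dom C f). \<forall>h \<in> homs C W (Dom C f).
       Comp C f g = Comp C f h \<longrightarrow> g = h)"

definition epic :: "('o, 'm, 'z) ab_cat_scheme \<Rightarrow> 'm \<Rightarrow> bool"
  where "epic C f \<longleftrightarrow> f \<in> Arr C \<and>
    (\<forall>W. \<forall>g \<in> homs C (Cod C f) W. \<forall>h \<in> homs C (Cod C f) W.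
       Comp C g f = Comp C h f \<longrightarrow> g = h)"

definition isomorphic :: "('o, 'm, 'z) ab_cat_scheme \<Rightarrow> 'o \<Rightarrow> 'o \<Rightarrow> bool"
  where "isomorphic C X Y \<longleftrightarrow> X \<in> Obj C \<and> Y \<in> Obj C \<and>
    (\<exists>f \<in> homs C X Y. \<exists>g \<in> homs C Y X. Comp C g f = Ident C X \<and> Comp C f g = Ident C Y)"

definition zero_object :: "('o, 'm, 'z) ab_cat_scheme \<Rightarrow> 'o \<Rightarrow> bool"
  where "zero_object C Z \<longleftrightarrow> Z \<in> Obj C \<and>
    (\<forall>X \<in> Obj C. (\<exists>!f. f \<in> homs C X Z) \<and> (\<exists>!f. f \<in> homs C Z X))"

definition has_biproduct :: "('o, 'm, 'z) ab_cat_scheme \<Rightarrow> 'o \<Rightarrow> 'o \<Rightarrow> bool"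
  where "has_biproduct C X Y \<longleftrightarrow>
    (\<exists>B \<in> Obj C. \<exists>i1 \<in> homs C X B. \<exists>i2 \<in> homs C Y B. \<exists>p1 \<in> homs C B X. \<exists>p2 \<in> homs C B Y.
       Comp C p1 i1 = Ident C X \<and> Comp C p2 i2 = Ident C Y \<and>
       Plus C (Comp C i1 p1) (Comp C i2 p2) = Ident C B)"

definition is_kernel :: "('o, 'm, 'z) ab_cat_scheme \<Rightarrow> 'm \<Rightarrow> 'm \<Rightarrow> bool"
  where "is_kernel C k f \<longleftrightarrow> f \<in> Arr C \<and> k \<in> Arr C \<and> Cod C k = Dom C f \<and>
    Comp C f k = Zero C (Dom C k) (Cod C f) \<and>
    (\<forall>W. \<forall>g \<in> homs C W (Dom C f). Comp C f g = Zero C W (Cod C f) \<longrightarrow>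
       (\<exists>!u. u \<in> homs C W (Dom C k) \<and> Comp C k u = g))"

definition is_cokernel :: "('o, 'm, 'z) ab_cat_scheme \<Rightarrow> 'm \<Rightarrow> 'm \<Rightarrow> bool"
  where "is_cokernel C c f \<longleftrightarrow> f \<in> Arr C \<and> c \<in> Arr C \<and> Dom C c = Cod C f \<and>
    Comp C c f = Zero C (Dom C f) (Cod C c) \<and>
    (\<forall>W. \<forall>g \<in> homs C (Cod C f) W. Comp C g f = Zero C (Dom C f) W \<longrightarrow>
       (\<exists>!u. u \<in> homs C (Cod C c) W \<and> Comp C u c = g))"

locale abelian_category = preadditive_category +
  assumes ex_zero_object: "\<exists>Z. zero_object C Z"
    and ex_biproduct: "X \<in> Obj C \<Longrightarrow> Y \<in> Obj C \<Longrightarrow> has_biproduct C X Y"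
    and ex_kernel: "f \<in> Arr C \<Longrightarrow> \<exists>k. is_kernel C k f"
    and ex_cokernel: "f \<in> Arr C \<Longrightarrow> \<exists>c. is_cokernel C c f"
    and monic_normal: "monic C f \<Longrightarrow> \<exists>g. is_kernel C f g"
    and epic_normal: "epic C f \<Longrightarrow> \<exists>g. is_cokernel C f g"

definition is_image :: "('o, 'm, 'z) ab_cat_scheme \<Rightarrow> 'm \<Rightarrow> 'm \<Rightarrow> bool"
  where "is_image C m f \<longleftrightarrow> (\<exists>c. is_cokernel C c f \<and> is_kernel C m c)"

(* Image and kernel are subobjects, i.e. determined up to isomorphism; they agree iff one
   monomorphism represents both. *)
definition exact_pair :: "('o, 'm, 'z) ab_cat_scheme \<Rightarrow> 'm \<Rightarrow> 'm \<Rightarrow> bool"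
  where "exact_pair C f g \<longleftrightarrow> f \<in> Arr C \<and> g \<in> Arr C \<and> Cod C f = Dom C g \<and>
    (\<exists>m. is_image C m f \<and> is_kernel C m g)"

definition short_exact :: "('o, 'm, 'z) ab_cat_scheme \<Rightarrow> 'm \<Rightarrow> 'm \<Rightarrow> bool"
  where "short_exact C i p \<longleftrightarrow> monic C i \<and> exact_pair C i p \<and> epic C p"

(* Yoneda Ext: the category is not assumed to have enough projectives or injectives.
   (a, b, c) is an exact sequence 0 --> Y --a--> E --b--> F --c--> X --> 0. *)
definition two_extensions :: "('o, 'm, 'z) ab_cat_scheme \<Rightarrow> 'o \<Rightarrow> 'o \<Rightarrow> ('m \<times> 'm \<times> 'm) set"
  where "two_extensions C X Y = {(a, b, c). Dom C a = Y \<and> Cod C c = X \<and>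
    monic C a \<and> exact_pair C a b \<and> exact_pair C b c \<and> epic C c}"

(* A morphism of two-extensions that is the identity on both ends. *)
definition two_extension_map ::
    "('o, 'm, 'z) ab_cat_scheme \<Rightarrow> 'o \<Rightarrow> 'o \<Rightarrow> 'm \<times> 'm \<times> 'm \<Rightarrow> 'm \<times> 'm \<times> 'm \<Rightarrow> bool"
  where "two_extension_map C X Y = (\<lambda>(a, b, c) (a', b', c').
    (a, b, c) \<in> two_extensions C X Y \<and> (a', b', c') \<in> two_extensions C X Y \<and>
    (\<exists>u \<in> homs C (Cod C a) (Cod C a'). \<exists>v \<in> homs C (Cod C b) (Cod C b').
       Comp C u a = a' \<and> Comp C v b = Comp C b' u \<and> Comp C c' v = c))"

definition yoneda_class ::
    "('o, 'm, 'z) ab_cat_scheme \<Rightarrow> 'o \<Rightarrow> 'o \<Rightarrow> 'm \<times> 'm \<times> 'm \<Rightarrow> ('m \<times> 'm \<times> 'm) set"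
  where "yoneda_class C X Y e = {e'. equivclp (two_extension_map C X Y) e e'}"

definition Ext2 :: "('o, 'm, 'z) ab_cat_scheme \<Rightarrow> 'o \<Rightarrow> 'o \<Rightarrow> ('m \<times> 'm \<times> 'm) set set"
  where "Ext2 C X Y = yoneda_class C X Y ` two_extensions C X Y"

(* The neutral element for the Baer sum: the class of
   0 --> Y --1--> Y --0--> X --1--> X --> 0. *)
definition Ext2_zero :: "('o, 'm, 'z) ab_cat_scheme \<Rightarrow> 'o \<Rightarrow> 'o \<Rightarrow> ('m \<times> 'm \<times> 'm) set"
  where "Ext2_zero C X Y = yoneda_class C X Y (Ident C Y, Zero C Y X, Ident C X)"

locale hereditary_abelian_category = abelian_category +
  assumes hereditary: "X \<in> Obj C \<Longrightarrow> Y \<in> Obj C \<Longrightarrow> Ext2 C X Y = {Ext2_zero C X Y}"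

(* Full subcategories are identified with their sets of objects. *)
definition subcategory :: "('o, 'm, 'z) ab_cat_scheme \<Rightarrow> 'o set \<Rightarrow> bool"
  where "subcategory C S \<longleftrightarrow> S \<subseteq> Obj C \<and> S \<noteq> {} \<and>
    (\<forall>X \<in> S. \<forall>Y. isomorphic C X Y \<longrightarrow> Y \<in> S)"

definition full_sub :: "('o, 'm, 'z) ab_cat_scheme \<Rightarrow> 'o set \<Rightarrow> ('o, 'm, 'z) ab_cat_scheme"
  where "full_sub C S = C\<lparr>Obj := S, Arr := {f \<in> Arr C. Dom C f \<in> S \<and> Cod C f \<in> S}\<rparr>"

definition closed_under_kernels :: "('o, 'm, 'z) ab_cat_scheme \<Rightarrow> 'o set \<Rightarrow> bool"
  where "closed_under_kernels C S \<longleftrightarrow>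
    (\<forall>X \<in> S. \<forall>Y \<in> S. \<forall>f \<in> homs C X Y. \<forall>k. is_kernel C k f \<longrightarrow> Dom C k \<in> S)"

definition closed_under_cokernels :: "('o, 'm, 'z) ab_cat_scheme \<Rightarrow> 'o set \<Rightarrow> bool"
  where "closed_under_cokernels C S \<longleftrightarrow>
    (\<forall>X \<in> S. \<forall>Y \<in> S. \<forall>f \<in> homs C X Y. \<forall>c. is_cokernel C c f \<longrightarrow> Cod C c \<in> S)"

definition closed_under_extensions :: "('o, 'm, 'z) ab_cat_scheme \<Rightarrow> 'o set \<Rightarrow> bool"
  where "closed_under_extensions C S \<longleftrightarrow>
    (\<forall>i p. short_exact C i p \<and> Dom C i \<in> S \<and> Cod C p \<in> S \<longrightarrow> Cod C i \<in> S)"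

definition closed_under_quotients :: "('o, 'm, 'z) ab_cat_scheme \<Rightarrow> 'o set \<Rightarrow> bool"
  where "closed_under_quotients C S \<longleftrightarrow>
    (\<forall>p. epic C p \<and> Dom C p \<in> S \<longrightarrow> Cod C p \<in> S)"

definition narrow :: "('o, 'm, 'z) ab_cat_scheme \<Rightarrow> 'o set \<Rightarrow> bool"
  where "narrow C N \<longleftrightarrow>
    subcategory C N \<and> closed_under_extensions C N \<and> closed_under_cokernels C N"

definition wide :: "('o, 'm, 'z) ab_cat_scheme \<Rightarrow> 'o set \<Rightarrow> bool"
  where "wide C W \<longleftrightarrow> subcategory C W \<and>
    closed_under_kernels C W \<and> closed_under_cokernels C W \<and> closed_under_extensions C W"

definition wide_closure :: "('o, 'm, 'z) ab_cat_scheme \<Rightarrow> 'o set \<Rightarrow> 'o set"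
  where "wide_closure C N = \<Inter> {W. wide C W \<and> N \<subseteq> W}"

definition nullity_class :: "('o, 'm, 'z) ab_cat_scheme \<Rightarrow> 'o set \<Rightarrow> bool"
  where "nullity_class B T \<longleftrightarrow>
    subcategory B T \<and> closed_under_quotients B T \<and> closed_under_extensions B T"

definition tilting :: "('o, 'm, 'z) ab_cat_scheme \<Rightarrow> 'o set \<Rightarrow> bool"
  where "tilting B T \<longleftrightarrow> (\<forall>X \<in> Obj B. \<exists>f. monic B f \<and> Dom B f = X \<and> Cod B f \<in> T)"

end

theory Submission
  imports Defs
begin

text \<open>
  Let \<open>N\<close> be narrow in a hereditary abelian category. The wide closure of \<open>N\<close> turns out to consist
  of the kernels of arrows between objects of \<open>N\<close> (\<open>kernels_in\<close>), and everything follows from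
  a study of these kernels.

  Heredity enters through one construction. For an arrow \<open>b: B \<longrightarrow> D\<close> with kernel \<open>a: A \<longrightarrow> B\<close> and
  cokernel \<open>c: D \<longrightarrow> E\<close>, the sequence \<open>0 \<longrightarrow> A \<longrightarrow> B \<longrightarrow> D \<longrightarrow> E \<longrightarrow> 0\<close> represents an element of the second
  Ext group. When this element vanishes, \<open>b\<close> factors as \<open>B \<longrightarrow> F \<longrightarrow> D\<close>, a monomorphism
  followed by an epimorphism, in such a way that \<open>0 \<longrightarrow> A \<longrightarrow> F \<longrightarrow> D \<longrightarrow> 0\<close> and \<open>0 \<longrightarrow> B \<longrightarrow> F \<longrightarrow> E \<longrightarrow> 0\<close> are
  exact; \<open>F\<close> is then called a blended extension. Indeed the split sequence has a blended extension,
  and having one is invariant under morphisms of two-extensions in both directions (\<open>blended_pullback\<close>, \<open>blended_pushout\<close>). Hence in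
  a hereditary category every arrow has a blended extension (\<open>ex_blended\<close>).

  Three consequences carry the theorem. If \<open>B\<close> and \<open>D\<close> lie in \<open>N\<close>, so do \<open>E\<close> and the extension \<open>F\<close> of
  \<open>E\<close> by \<open>B\<close>; thus every kernel \<open>A\<close> of an arrow of \<open>N\<close> sits in a short exact sequence
  \<open>0 \<longrightarrow> A \<longrightarrow> F \<longrightarrow> D \<longrightarrow> 0\<close> with \<open>F\<close> and \<open>D\<close> in \<open>N\<close> (\<open>resolution\<close>), which gives the tilting property. The
  image \<open>I\<close> of such an arrow fits into \<open>0 \<longrightarrow> B \<longrightarrow> F \<oplus> I \<longrightarrow> D \<longrightarrow> 0\<close>, so \<open>F \<oplus> I\<close> lies in \<open>N\<close>, and so does its
  direct summand \<open>I\<close> (\<open>image_in_N\<close>); this gives closure under quotients, since a quotient of an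
  object of \<open>N\<close> that embeds into \<open>N\<close> is such an image. Finally the kernels of arrows of \<open>N\<close> form a
  wide subcategory (\<open>wide_kernels_in\<close>): kernels and cokernels are reduced to arrows in or out of \<open>N\<close>
  by pushouts along resolutions, and extensions need the blended extension once more.

  The converse is formal. Cokernels and extensions of objects of \<open>N\<close> are computed in the wide
  closure, a cokernel is a quotient, and so a nullity class in the wide closure is narrow.
\<close>

section \<open>Arrows, zero arrows and signs\<close>

context category
begin

lemma homs_iff: "f \<in> homs C X Y \<longleftrightarrow> f \<in> Arr C \<and> Dom C f = X \<and> Cod C f = Y"
  by (auto simp: homs_def)

lemma Dom_Obj [simp]: "f \<in> Arr C \<Longrightarrow> Dom C f \<in> Obj C"
  and Cod_Obj [simp]: "f \<in> Arr C \<Longrightarrow> Cod C f \<in> Obj C"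
  using Dom_closed Cod_closed by auto

lemma Ident_Arr [simp]:
  assumes "X \<in> Obj C"
  shows "Ident C X \<in> Arr C" "Dom C (Ident C X) = X" "Cod C (Ident C X) = X"
  using Ident_closed[OF assms] by (auto simp: homs_iff)

lemma Comp_Arr [simp]:
  assumes "f \<in> Arr C" "g \<in> Arr C" "Dom C g = Cod C f"
  shows "g \<cdot> f \<in> Arr C" "Dom C (g \<cdot> f) = Dom C f" "Cod C (g \<cdot> f) = Cod C g"
  using Comp_closed[of f "Dom C f" "Cod C f" g "Cod C g"] assms by (auto simp: homs_iff)

lemma Comp_Ident_Arr [simp]: "f \<in> Arr C \<Longrightarrow> Dom C f = X \<Longrightarrow> f \<cdot> Ident C X = f"
  and Ident_Comp_Arr [simp]: "f \<in> Arr C \<Longrightarrow> Cod C f = X \<Longrightarrow> Ident C X \<cdot> f = f"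
  using Comp_Ident[of f X "Cod C f"] Ident_Comp[of f "Dom C f" X] by (auto simp: homs_iff)

lemma assoc:
  assumes "f \<in> Arr C" "g \<in> Arr C" "h \<in> Arr C" "Dom C g = Cod C f" "Dom C h = Cod C g"
  shows "(h \<cdot> g) \<cdot> f = h \<cdot> (g \<cdot> f)"
  using Comp_assoc[of f "Dom C f" "Cod C f" g "Cod C g" h "Cod C h"] assms
  by (auto simp: homs_iff)

lemma reassoc:
  assumes "h \<cdot> g = k" "f \<in> Arr C" "g \<in> Arr C" "h \<in> Arr C" "Dom C g = Cod C f" "Dom C h = Cod C g"
  shows "h \<cdot> (g \<cdot> f) = k \<cdot> f"
  using assoc[of f g h] assms by simp

lemma monic_Arr: "monic C f \<Longrightarrow> f \<in> Arr C"
  by (simp add: monic_def)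

lemma epic_Arr: "epic C f \<Longrightarrow> f \<in> Arr C"
  by (simp add: epic_def)

lemma monic_cancel:
  assumes "monic C f" "x \<in> Arr C" "y \<in> Arr C" "Cod C x = Dom C f" "Cod C y = Dom C f"
    "Dom C x = Dom C y" "f \<cdot> x = f \<cdot> y"
  shows "x = y"
  using assms unfolding monic_def homs_def by blast

lemma epic_cancel:
  assumes "epic C f" "x \<in> Arr C" "y \<in> Arr C" "Dom C x = Cod C f" "Dom C y = Cod C f"
    "Cod C x = Cod C y" "x \<cdot> f = y \<cdot> f"
  shows "x = y"
  using assms unfolding epic_def homs_def by blast

lemma epic_Comp:
  assumes "epic C f" "epic C g" "Dom C g = Cod C f"
  shows "epic C (g \<cdot> f)"
proof -
  have [simp]: "f \<in> Arr C" "g \<in> Arr C" using assms epic_Arr by auto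
  show ?thesis
    unfolding epic_def
  proof (intro conjI allI ballI impI)
    fix W x y
    assume "x \<in> homs C (Cod C (g \<cdot> f)) W" "y \<in> homs C (Cod C (g \<cdot> f)) W"
    then have [simp]: "x \<in> Arr C" "y \<in> Arr C" "Dom C x = Cod C g" "Dom C y = Cod C g"
      and W: "Cod C x = W" "Cod C y = W"
      using assms(3) by (auto simp: homs_iff)
    assume "x \<cdot> (g \<cdot> f) = y \<cdot> (g \<cdot> f)"
    then have "(x \<cdot> g) \<cdot> f = (y \<cdot> g) \<cdot> f" using assms(3) by (simp add: assoc)
    then have "x \<cdot> g = y \<cdot> g"
      using epic_cancel[OF assms(1), of "x \<cdot> g" "y \<cdot> g"] assms(3) W by simp
    then show "x = y" using epic_cancel[OF assms(2)] W by simp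
  qed (use assms in simp)
qed

end

definition neg :: "('o, 'm, 'z) ab_cat_scheme \<Rightarrow> 'm \<Rightarrow> 'm"
  where "neg C f = inv\<^bsub>hom_group C (Dom C f) (Cod C f)\<^esub> f"

context preadditive_category
begin

lemma Zero_Arr [simp]:
  assumes "X \<in> Obj C" "Y \<in> Obj C"
  shows "Zero C X Y \<in> Arr C" "Dom C (Zero C X Y) = X" "Cod C (Zero C X Y) = Y"
proof -
  interpret G: comm_group "hom_group C X Y" using assms by (rule hom_comm_group)
  show "Zero C X Y \<in> Arr C" "Dom C (Zero C X Y) = X" "Cod C (Zero C X Y) = Y"
    using G.one_closed by (auto simp: hom_group_def homs_iff)
qed

lemma Plus_Arr [simp]:
  assumes "f \<in> Arr C" "g \<in> Arr C" "Dom C f = Dom C g" "Cod C f = Cod C g"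
  shows "f \<oplus> g \<in> Arr C" "Dom C (f \<oplus> g) = Dom C g" "Cod C (f \<oplus> g) = Cod C g"
proof -
  interpret G: comm_group "hom_group C (Dom C g) (Cod C g)" using assms by (intro hom_comm_group) auto
  show "f \<oplus> g \<in> Arr C" "Dom C (f \<oplus> g) = Dom C g" "Cod C (f \<oplus> g) = Cod C g"
    using G.m_closed[of f g] assms by (auto simp: hom_group_def homs_iff)
qed

lemma Plus_Zero [simp]:
  assumes "f \<in> Arr C" "Dom C f = X" "Cod C f = Y"
  shows "f \<oplus> Zero C X Y = f" "Zero C X Y \<oplus> f = f"
proof -
  interpret G: comm_group "hom_group C X Y" using assms by (intro hom_comm_group) auto
  show "f \<oplus> Zero C X Y = f" "Zero C X Y \<oplus> f = f"
    using G.r_one[of f] G.l_one[of f] assms by (auto simp: hom_group_def homs_iff)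
qed

lemma neg_Arr [simp]:
  assumes "f \<in> Arr C"
  shows "neg C f \<in> Arr C" "Dom C (neg C f) = Dom C f" "Cod C (neg C f) = Cod C f"
proof -
  interpret G: comm_group "hom_group C (Dom C f) (Cod C f)" using assms by (intro hom_comm_group) auto
  show "neg C f \<in> Arr C" "Dom C (neg C f) = Dom C f" "Cod C (neg C f) = Cod C f"
    using G.inv_closed[of f] assms unfolding neg_def by (auto simp: hom_group_def homs_iff)
qed

lemma Plus_neg [simp]:
  assumes "f \<in> Arr C"
  shows "f \<oplus> neg C f = Zero C (Dom C f) (Cod C f)" "neg C f \<oplus> f = Zero C (Dom C f) (Cod C f)"
proof -
  interpret G: comm_group "hom_group C (Dom C f) (Cod C f)" using assms by (intro hom_comm_group) auto
  show "f \<oplus> neg C f = Zero C (Dom C f) (Cod C f)" "neg C f \<oplus> f = Zero C (Dom C f) (Cod C f)"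
    using G.r_inv[of f] G.l_inv[of f] assms unfolding neg_def by (auto simp: hom_group_def homs_iff)
qed

lemma Plus_right_cancel:
  assumes "f \<in> Arr C" "g \<in> Arr C" "h \<in> Arr C" "Dom C f = Dom C h" "Cod C f = Cod C h"
    "Dom C g = Dom C h" "Cod C g = Cod C h" "f \<oplus> h = g \<oplus> h"
  shows "f = g"
proof -
  interpret G: comm_group "hom_group C (Dom C h) (Cod C h)" using assms by (intro hom_comm_group) auto
  show ?thesis using G.right_cancel[of h f g] assms by (auto simp: hom_group_def homs_iff)
qed

lemma Plus_commute:
  assumes "f \<in> Arr C" "g \<in> Arr C" "Dom C f = Dom C g" "Cod C f = Cod C g"
  shows "f \<oplus> g = g \<oplus> f"
proof -
  interpret G: comm_group "hom_group C (Dom C g) (Cod C g)" using assms by (intro hom_comm_group) auto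
  show ?thesis using G.m_comm[of f g] assms by (auto simp: hom_group_def homs_iff)
qed

lemma distrib_left:
  assumes "f \<in> Arr C" "f' \<in> Arr C" "g \<in> Arr C" "Dom C f = Dom C f'" "Cod C f = Cod C f'"
    "Dom C g = Cod C f'"
  shows "g \<cdot> (f \<oplus> f') = (g \<cdot> f) \<oplus> (g \<cdot> f')"
  using Comp_Plus[of f "Dom C f'" "Cod C f'" f' g "Cod C g"] assms by (auto simp: homs_iff)

lemma distrib_right:
  assumes "f \<in> Arr C" "g \<in> Arr C" "g' \<in> Arr C" "Dom C g = Dom C g'" "Cod C g = Cod C g'"
    "Dom C g' = Cod C f"
  shows "(g \<oplus> g') \<cdot> f = (g \<cdot> f) \<oplus> (g' \<cdot> f)"
  using Plus_Comp[of f "Dom C f" "Cod C f" g "Cod C g'" g'] assms by (auto simp: homs_iff)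

lemma Comp_Zero [simp]:
  assumes "f \<in> Arr C" "Dom C f = Y" "X \<in> Obj C"
  shows "f \<cdot> Zero C X Y = Zero C X (Cod C f)"
proof -
  have Y: "Y \<in> Obj C" using assms by auto
  let ?z = "f \<cdot> Zero C X Y"
  have "?z \<oplus> ?z = f \<cdot> (Zero C X Y \<oplus> Zero C X Y)"
    using assms Y by (subst distrib_left) auto
  also have "\<dots> = Zero C X (Cod C f) \<oplus> ?z" using assms Y by simp
  finally show ?thesis using assms Y by (intro Plus_right_cancel[of ?z _ ?z]) auto
qed

lemma Zero_Comp [simp]:
  assumes "f \<in> Arr C" "Cod C f = X" "Y \<in> Obj C"
  shows "Zero C X Y \<cdot> f = Zero C (Dom C f) Y"
proof -
  have X: "X \<in> Obj C" using assms by auto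
  let ?z = "Zero C X Y \<cdot> f"
  have "?z \<oplus> ?z = (Zero C X Y \<oplus> Zero C X Y) \<cdot> f"
    using assms X by (subst distrib_right) auto
  also have "\<dots> = Zero C (Dom C f) Y \<oplus> ?z" using assms X by simp
  finally show ?thesis using assms X by (intro Plus_right_cancel[of ?z _ ?z]) auto
qed

lemma eq_negI:
  assumes "f \<in> Arr C" "g \<in> Arr C" "Dom C f = Dom C g" "Cod C f = Cod C g"
    "f \<oplus> g = Zero C (Dom C g) (Cod C g)"
  shows "f = neg C g"
  using assms by (intro Plus_right_cancel[of f "neg C g" g]) auto

lemma neg_neg [simp]: "f \<in> Arr C \<Longrightarrow> neg C (neg C f) = f"
  using eq_negI[of f "neg C f"] by simp

lemma neg_Zero [simp]: "X \<in> Obj C \<Longrightarrow> Y \<in> Obj C \<Longrightarrow> neg C (Zero C X Y) = Zero C X Y"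
  using eq_negI[of "Zero C X Y" "Zero C X Y"] by simp

lemma Comp_neg [simp]:
  assumes "f \<in> Arr C" "g \<in> Arr C" "Dom C g = Cod C f"
  shows "g \<cdot> neg C f = neg C (g \<cdot> f)"
proof -
  have "(g \<cdot> neg C f) \<oplus> (g \<cdot> f) = g \<cdot> (neg C f \<oplus> f)"
    using assms by (subst distrib_left) auto
  then show ?thesis using assms by (intro eq_negI) auto
qed

lemma neg_Comp [simp]:
  assumes "f \<in> Arr C" "g \<in> Arr C" "Dom C g = Cod C f"
  shows "neg C g \<cdot> f = neg C (g \<cdot> f)"
proof -
  have "(neg C g \<cdot> f) \<oplus> (g \<cdot> f) = (neg C g \<oplus> g) \<cdot> f"
    using assms by (subst distrib_right) auto
  then show ?thesis using assms by (intro eq_negI) auto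
qed

lemma monicI:
  assumes "f \<in> Arr C"
    and "\<And>x. x \<in> Arr C \<Longrightarrow> Cod C x = Dom C f \<Longrightarrow> f \<cdot> x = Zero C (Dom C x) (Cod C f) \<Longrightarrow>
      x = Zero C (Dom C x) (Dom C f)"
  shows "monic C f"
  unfolding monic_def
proof (intro conjI allI ballI impI)
  fix W x y
  assume xy: "x \<in> homs C W (Dom C f)" "y \<in> homs C W (Dom C f)" "f \<cdot> x = f \<cdot> y"
  then have [simp]: "x \<in> Arr C" "y \<in> Arr C" "Dom C x = W" "Dom C y = W" "Cod C x = Dom C f"
    "Cod C y = Dom C f" by (auto simp: homs_iff)
  have "W \<in> Obj C" using Dom_Obj[of x] by simp
  have "f \<cdot> (x \<oplus> neg C y) = (f \<cdot> x) \<oplus> neg C (f \<cdot> x)"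
    using assms(1) xy(3) by (subst distrib_left) auto
  also have "\<dots> = Zero C W (Cod C f)" using assms(1) by simp
  finally have "x \<oplus> neg C y = Zero C W (Dom C f)"
    using assms(2)[of "x \<oplus> neg C y"] assms(1) by simp
  then show "x = y" using eq_negI[of x "neg C y"] by simp
qed (use assms in simp)

lemma monicD:
  assumes "monic C f" "x \<in> Arr C" "Cod C x = Dom C f" "f \<cdot> x = Zero C (Dom C x) (Cod C f)"
  shows "x = Zero C (Dom C x) (Dom C f)"
  using assms monic_Arr[of f] by (intro monic_cancel[OF assms(1), of x "Zero C (Dom C x) (Dom C f)"]) auto

end

section \<open>Duality\<close>

text \<open>The axioms of an abelian category are self-dual, so that every result below has a dual, obtained
  by applying it to the opposite category.\<close>

definition opposite :: "('o, 'm, 'z) ab_cat_scheme \<Rightarrow> ('o, 'm, 'z) ab_cat_scheme"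
  where "opposite C = C\<lparr>Dom := Cod C, Cod := Dom C, Comp := \<lambda>g f. Comp C f g,
    Zero := \<lambda>X Y. Zero C Y X\<rparr>"

lemma opposite_simps [simp]:
  "Obj (opposite C) = Obj C" "Arr (opposite C) = Arr C" "Dom (opposite C) = Cod C"
  "Cod (opposite C) = Dom C" "Ident (opposite C) = Ident C" "Comp (opposite C) g f = Comp C f g"
  "Plus (opposite C) = Plus C" "Zero (opposite C) X Y = Zero C Y X"
  "homs (opposite C) X Y = homs C Y X"
  by (auto simp: opposite_def homs_def)

lemma hom_group_opposite: "hom_group (opposite C) X Y = hom_group C Y X"
  by (simp add: hom_group_def)

lemma monic_opposite [simp]: "monic (opposite C) f = epic C f"
  and epic_opposite [simp]: "epic (opposite C) f = monic C f"
  by (simp_all add: monic_def epic_def)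

lemma is_kernel_opposite [simp]: "is_kernel (opposite C) k f = is_cokernel C k f"
  and is_cokernel_opposite [simp]: "is_cokernel (opposite C) k f = is_kernel C k f"
  by (auto simp: is_kernel_def is_cokernel_def)

lemma zero_object_opposite: "zero_object (opposite C) Z = zero_object C Z"
  by (auto simp: zero_object_def)

lemma has_biproduct_opposite: "has_biproduct (opposite C) X Y = has_biproduct C X Y"
  by (auto simp: has_biproduct_def) blast+

lemma (in abelian_category) abelian_opposite: "abelian_category (opposite C)"
proof (intro abelian_category.intro preadditive_category.intro category.intro
    preadditive_category_axioms.intro abelian_category_axioms.intro)
  fix X Y assume "X \<in> Obj (opposite C)" "Y \<in> Obj (opposite C)"
  then show "comm_group (hom_group (opposite C) X Y)" "has_biproduct (opposite C) X Y"
    by (simp_all add: hom_group_opposite hom_comm_group has_biproduct_opposite ex_biproduct)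
qed (auto simp: zero_object_opposite ex_zero_object ex_kernel ex_cokernel monic_normal epic_normal
  distrib_left distrib_right homs_iff assoc)

lemma (in category) opposite_category: "category (opposite C)"
  by (rule category.intro) (auto simp: homs_iff assoc)

lemma (in category) monic_Comp:
  "monic C f \<Longrightarrow> monic C g \<Longrightarrow> Dom C g = Cod C f \<Longrightarrow> monic C (g \<cdot> f)"
  using category.epic_Comp[OF opposite_category, of g f] by simp

section \<open>Kernels, cokernels and short exact sequences\<close>

text \<open>Kernel-cokernel pairs: this description of short exact sequences is visibly self-dual and gives
  both universal properties at once.\<close>

definition ses :: "('o, 'm, 'z) ab_cat_scheme \<Rightarrow> 'm \<Rightarrow> 'm \<Rightarrow> bool"
  where "ses C i p \<longleftrightarrow> is_kernel C i p \<and> is_cokernel C p i"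

lemma ses_opposite [simp]: "ses (opposite C) i p = ses C p i"
  by (auto simp: ses_def)

lemma is_kernel_Arr:
  assumes "is_kernel C k f"
  shows "k \<in> Arr C" "f \<in> Arr C" "Cod C k = Dom C f" "Comp C f k = Zero C (Dom C k) (Cod C f)"
  using assms by (auto simp: is_kernel_def)

lemma is_cokernel_Arr:
  assumes "is_cokernel C c f"
  shows "c \<in> Arr C" "f \<in> Arr C" "Dom C c = Cod C f" "Comp C c f = Zero C (Dom C f) (Cod C c)"
  using assms by (auto simp: is_cokernel_def)

lemma is_kernelE:
  assumes "is_kernel C k f" "x \<in> Arr C" "Cod C x = Dom C f"
    "Comp C f x = Zero C (Dom C x) (Cod C f)"
  obtains u where "u \<in> Arr C" "Dom C u = Dom C x" "Cod C u = Dom C k" "Comp C k u = x"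
  using assms unfolding is_kernel_def homs_def by blast

lemma is_cokernelE:
  assumes "is_cokernel C c f" "x \<in> Arr C" "Dom C x = Cod C f"
    "Comp C x f = Zero C (Dom C f) (Cod C x)"
  obtains u where "u \<in> Arr C" "Cod C u = Cod C x" "Dom C u = Cod C c" "Comp C u c = x"
  using assms unfolding is_cokernel_def homs_def by blast

context abelian_category
begin

lemma kernel_monic:
  assumes "is_kernel C k f"
  shows "monic C k"
proof (rule monicI)
  note [simp] = is_kernel_Arr[OF assms]
  show "k \<in> Arr C" by simp
  fix x assume [simp]: "x \<in> Arr C" "Cod C x = Dom C k"
  assume 0: "k \<cdot> x = Zero C (Dom C x) (Cod C k)"
  have "Zero C (Dom C x) (Dom C f) \<in> homs C (Dom C x) (Dom C f)"
    "f \<cdot> Zero C (Dom C x) (Dom C f) = Zero C (Dom C x) (Cod C f)"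
    by (auto simp: homs_iff)
  then have "\<exists>!u. u \<in> homs C (Dom C x) (Dom C k) \<and> k \<cdot> u = Zero C (Dom C x) (Dom C f)"
    using assms unfolding is_kernel_def by blast
  moreover have "x \<in> homs C (Dom C x) (Dom C k) \<and> k \<cdot> x = Zero C (Dom C x) (Dom C f)"
    using 0 by (simp add: homs_iff)
  moreover have "Zero C (Dom C x) (Dom C k) \<in> homs C (Dom C x) (Dom C k) \<and>
      k \<cdot> Zero C (Dom C x) (Dom C k) = Zero C (Dom C x) (Dom C f)"
    by (simp add: homs_iff)
  ultimately show "x = Zero C (Dom C x) (Dom C k)" by blast
qed

lemma cokernel_epic: "is_cokernel C c f \<Longrightarrow> epic C c"
  using abelian_category.kernel_monic[OF abelian_opposite, of c f] by simp

lemma is_kernelI: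
  assumes "monic C k" "f \<in> Arr C" "Cod C k = Dom C f" "f \<cdot> k = Zero C (Dom C k) (Cod C f)"
    and "\<And>x. x \<in> Arr C \<Longrightarrow> Cod C x = Dom C f \<Longrightarrow> f \<cdot> x = Zero C (Dom C x) (Cod C f) \<Longrightarrow>
      \<exists>u \<in> Arr C. Dom C u = Dom C x \<and> Cod C u = Dom C k \<and> k \<cdot> u = x"
  shows "is_kernel C k f"
  unfolding is_kernel_def
proof (intro conjI allI ballI impI)
  fix W x
  assume x: "x \<in> homs C W (Dom C f)" "f \<cdot> x = Zero C W (Cod C f)"
  then obtain u where "u \<in> Arr C" "Dom C u = W" "Cod C u = Dom C k" "k \<cdot> u = x"
    using assms(5)[of x] by (auto simp: homs_iff)
  then show "\<exists>!u. u \<in> homs C W (Dom C k) \<and> k \<cdot> u = x"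
    by (intro ex1I[of _ u]) (auto simp: homs_iff intro!: monic_cancel[OF assms(1)])
qed (use assms monic_Arr in auto)

lemma is_cokernelI:
  assumes "epic C c" "f \<in> Arr C" "Dom C c = Cod C f" "c \<cdot> f = Zero C (Dom C f) (Cod C c)"
    and "\<And>x. x \<in> Arr C \<Longrightarrow> Dom C x = Cod C f \<Longrightarrow> x \<cdot> f = Zero C (Dom C f) (Cod C x) \<Longrightarrow>
      \<exists>u \<in> Arr C. Cod C u = Cod C x \<and> Dom C u = Cod C c \<and> u \<cdot> c = x"
  shows "is_cokernel C c f"
  using abelian_category.is_kernelI[OF abelian_opposite, of c f] assms by simp

lemma monic_kernel_of_cokernel:
  assumes "monic C i" "is_cokernel C c i"
  shows "is_kernel C i c"
proof -
  obtain g where g: "is_kernel C i g" using monic_normal[OF assms(1)] by blast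
  note [simp] = is_kernel_Arr[OF g] is_cokernel_Arr[OF assms(2)]
  obtain u where [simp]: "u \<in> Arr C" "Cod C u = Cod C g" "Dom C u = Cod C c" and u: "u \<cdot> c = g"
    using is_cokernelE[OF assms(2), of g] by auto
  show ?thesis
  proof (rule is_kernelI[OF assms(1)])
    fix x assume x [simp]: "x \<in> Arr C" "Cod C x = Dom C c" "c \<cdot> x = Zero C (Dom C x) (Cod C c)"
    have "g \<cdot> x = u \<cdot> (c \<cdot> x)" by (subst reassoc[OF u]) auto
    then have "g \<cdot> x = Zero C (Dom C x) (Cod C g)" by simp
    then show "\<exists>u \<in> Arr C. Dom C u = Dom C x \<and> Cod C u = Dom C i \<and> i \<cdot> u = x"
      using is_kernelE[OF g, of x] by auto
  qed auto
qed

lemma epic_cokernel_of_kernel: "epic C p \<Longrightarrow> is_kernel C k p \<Longrightarrow> is_cokernel C p k"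
  using abelian_category.monic_kernel_of_cokernel[OF abelian_opposite, of p k] by simp

lemma ses_kernelI: "is_kernel C i p \<Longrightarrow> epic C p \<Longrightarrow> ses C i p"
  by (simp add: ses_def epic_cokernel_of_kernel)

lemma ses_cokernelI: "is_cokernel C p i \<Longrightarrow> monic C i \<Longrightarrow> ses C i p"
  by (simp add: ses_def monic_kernel_of_cokernel)

lemma monic_ex_ses:
  assumes "monic C i"
  obtains p where "ses C i p"
  using ses_cokernelI assms ex_cokernel[of i] monic_Arr by blast

text \<open>Exactness of a pair is stated with one arrow that is both image and kernel. This lemma moves the
  property of being a kernel to any other arrow representing the same subobject, without choosing
  an isomorphism between the two representatives.\<close>

lemma kernel_transfer:
  assumes "is_kernel C m b" "is_kernel C m c" "is_kernel C a c"
  shows "is_kernel C a b"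
proof (rule is_kernelI)
  note [simp] = is_kernel_Arr[OF assms(1)] is_kernel_Arr[OF assms(2)] is_kernel_Arr[OF assms(3)]
  show "monic C a" using assms kernel_monic by blast
  obtain v where v [simp]: "v \<in> Arr C" "Dom C v = Dom C a" "Cod C v = Dom C m" "m \<cdot> v = a"
    using is_kernelE[OF assms(2), of a] by auto
  have [simp]: "Dom C c = Dom C b"
    using is_kernel_Arr(3)[OF assms(1)] is_kernel_Arr(3)[OF assms(2)] by simp
  show "b \<in> Arr C" by simp
  show ab: "Cod C a = Dom C b" using is_kernel_Arr(3)[OF assms(2)] by simp
  have "b \<cdot> a = (b \<cdot> m) \<cdot> v" by (subst assoc) auto
  then show "b \<cdot> a = Zero C (Dom C a) (Cod C b)" by simp
  fix x assume x [simp]: "x \<in> Arr C" "Cod C x = Dom C b" "b \<cdot> x = Zero C (Dom C x) (Cod C b)"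
  obtain y where y [simp]: "y \<in> Arr C" "Dom C y = Dom C x" "Cod C y = Dom C m" and my: "m \<cdot> y = x"
    using is_kernelE[OF assms(1), of x] by auto
  have "c \<cdot> x = (c \<cdot> m) \<cdot> y" using my by (subst assoc) auto
  then have "c \<cdot> x = Zero C (Dom C x) (Cod C c)" by simp
  then show "\<exists>u \<in> Arr C. Dom C u = Dom C x \<and> Cod C u = Dom C a \<and> a \<cdot> u = x"
    using is_kernelE[OF assms(3), of x] ab by auto
qed

lemma cokernel_transfer:
  "is_cokernel C m b \<Longrightarrow> is_cokernel C m c \<Longrightarrow> is_cokernel C a c \<Longrightarrow> is_cokernel C a b"
  using abelian_category.kernel_transfer[OF abelian_opposite, of m b c a] by simp

lemma is_image_self: "monic C a \<Longrightarrow> is_image C a a"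
  using ex_cokernel[of a] monic_kernel_of_cokernel monic_Arr unfolding is_image_def by blast

lemma exact_pair_kernel:
  "monic C a \<Longrightarrow> exact_pair C a b \<longleftrightarrow> is_kernel C a b"
  using kernel_transfer is_image_self monic_kernel_of_cokernel is_kernel_Arr
  unfolding exact_pair_def is_image_def by metis

lemma exact_pair_cokernel:
  assumes "epic C c"
  shows "exact_pair C b c \<longleftrightarrow> is_cokernel C c b"
proof
  assume "exact_pair C b c"
  then obtain m c' where "is_cokernel C c' b" "is_kernel C m c'" "is_kernel C m c"
    unfolding exact_pair_def is_image_def by blast
  then show "is_cokernel C c b"
    using cokernel_transfer epic_cokernel_of_kernel cokernel_epic assms by blast
next
  assume c: "is_cokernel C c b"
  then obtain m where "is_kernel C m c" using ex_kernel is_cokernel_Arr by metis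
  then show "exact_pair C b c"
    using c is_cokernel_Arr[OF c] unfolding exact_pair_def is_image_def by auto
qed

lemma short_exact_iff_ses: "short_exact C i p \<longleftrightarrow> ses C i p"
proof
  show "short_exact C i p \<Longrightarrow> ses C i p"
    by (auto simp: short_exact_def exact_pair_kernel ses_kernelI)
  show "ses C i p \<Longrightarrow> short_exact C i p"
    using kernel_monic cokernel_epic exact_pair_kernel by (auto simp: short_exact_def ses_def)
qed

lemma two_extensions_iff:
  "(a, b, c) \<in> two_extensions C X Y \<longleftrightarrow>
    is_kernel C a b \<and> is_cokernel C c b \<and> Dom C a = Y \<and> Cod C c = X"
proof -
  have "monic C a \<and> exact_pair C a b \<longleftrightarrow> is_kernel C a b"
    using exact_pair_kernel kernel_monic by blast
  moreover have "exact_pair C b c \<and> epic C c \<longleftrightarrow> is_cokernel C c b"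
    using exact_pair_cokernel cokernel_epic by blast
  ultimately show ?thesis unfolding two_extensions_def by auto
qed

end

section \<open>Biproducts, pushouts and pullbacks\<close>

context abelian_category
begin

lemma biproductE:
  assumes "X \<in> Obj C" "Y \<in> Obj C"
  obtains S i1 i2 p1 p2 where
    "S \<in> Obj C" "i1 \<in> Arr C" "i2 \<in> Arr C" "p1 \<in> Arr C" "p2 \<in> Arr C"
    "Dom C i1 = X" "Cod C i1 = S" "Dom C i2 = Y" "Cod C i2 = S"
    "Dom C p1 = S" "Cod C p1 = X" "Dom C p2 = S" "Cod C p2 = Y"
    "p1 \<cdot> i1 = Ident C X" "p2 \<cdot> i2 = Ident C Y" "p1 \<cdot> i2 = Zero C Y X" "p2 \<cdot> i1 = Zero C X Y"
    "(i1 \<cdot> p1) \<oplus> (i2 \<cdot> p2) = Ident C S"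
proof -
  obtain S i1 i2 p1 p2 where [simp]: "S \<in> Obj C" and
    homs: "i1 \<in> homs C X S" "i2 \<in> homs C Y S" "p1 \<in> homs C S X" "p2 \<in> homs C S Y"
    and e1: "p1 \<cdot> i1 = Ident C X" and e2: "p2 \<cdot> i2 = Ident C Y"
    and s: "(i1 \<cdot> p1) \<oplus> (i2 \<cdot> p2) = Ident C S"
    using ex_biproduct[OF assms] unfolding has_biproduct_def by blast
  have [simp]: "i1 \<in> Arr C" "i2 \<in> Arr C" "p1 \<in> Arr C" "p2 \<in> Arr C"
    "Dom C i1 = X" "Cod C i1 = S" "Dom C i2 = Y" "Cod C i2 = S"
    "Dom C p1 = S" "Cod C p1 = X" "Dom C p2 = S" "Cod C p2 = Y"
    using homs by (auto simp: homs_iff)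
  note [simp] = assms
  have "Zero C Y S \<oplus> i2 = ((i1 \<cdot> p1) \<oplus> (i2 \<cdot> p2)) \<cdot> i2" by (simp add: s)
  also have "\<dots> = (i1 \<cdot> (p1 \<cdot> i2)) \<oplus> i2"
    by (subst distrib_right) (auto simp: assoc e2)
  finally have "Zero C Y S \<oplus> i2 = (i1 \<cdot> (p1 \<cdot> i2)) \<oplus> i2" .
  then have "Zero C Y S = i1 \<cdot> (p1 \<cdot> i2)"
    by (intro Plus_right_cancel[of "Zero C Y S" _ i2]) auto
  then have "p1 \<cdot> Zero C Y S = p1 \<cdot> (i1 \<cdot> (p1 \<cdot> i2))" by simp
  also have "\<dots> = p1 \<cdot> i2" by (subst reassoc[OF e1]) auto
  finally have z1: "p1 \<cdot> i2 = Zero C Y X" by simp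
  have "Zero C X S \<oplus> i1 = ((i1 \<cdot> p1) \<oplus> (i2 \<cdot> p2)) \<cdot> i1" by (simp add: s)
  also have "\<dots> = i1 \<oplus> (i2 \<cdot> (p2 \<cdot> i1))"
    by (subst distrib_right) (auto simp: assoc e1)
  also have "\<dots> = (i2 \<cdot> (p2 \<cdot> i1)) \<oplus> i1" by (rule Plus_commute) auto
  finally have "Zero C X S \<oplus> i1 = (i2 \<cdot> (p2 \<cdot> i1)) \<oplus> i1" .
  then have "Zero C X S = i2 \<cdot> (p2 \<cdot> i1)"
    by (intro Plus_right_cancel[of "Zero C X S" _ i1]) auto
  then have "p2 \<cdot> Zero C X S = p2 \<cdot> (i2 \<cdot> (p2 \<cdot> i1))" by simp
  also have "\<dots> = p2 \<cdot> i1" by (subst reassoc[OF e2]) auto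
  finally have z2: "p2 \<cdot> i1 = Zero C X Y" by simp
  show thesis by (rule that[of S i1 i2 p1 p2]) (use e1 e2 z1 z2 s in auto)
qed

end

text \<open>The arrow \<open>h\<close> is opposite to \<open>f\<close> and \<open>g\<close> is opposite to \<open>m\<close>. Pullbacks are pushouts in the
  opposite category.\<close>

definition is_pushout :: "('o, 'm, 'z) ab_cat_scheme \<Rightarrow> 'm \<Rightarrow> 'm \<Rightarrow> 'm \<Rightarrow> 'm \<Rightarrow> bool"
  where "is_pushout C m f h g \<longleftrightarrow> m \<in> Arr C \<and> f \<in> Arr C \<and> h \<in> Arr C \<and> g \<in> Arr C \<and>
    Dom C f = Dom C m \<and> Dom C h = Cod C m \<and> Dom C g = Cod C f \<and> Cod C h = Cod C g \<and>
    Comp C h m = Comp C g f \<and>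
    (\<forall>x \<in> Arr C. \<forall>y \<in> Arr C. Dom C x = Cod C m \<and> Dom C y = Cod C f \<and> Cod C x = Cod C y \<and>
       Comp C x m = Comp C y f \<longrightarrow>
       (\<exists>!u. u \<in> homs C (Cod C g) (Cod C x) \<and> Comp C u h = x \<and> Comp C u g = y))"

lemma pushout_Arr:
  assumes "is_pushout C m f h g"
  shows "m \<in> Arr C" "f \<in> Arr C" "h \<in> Arr C" "g \<in> Arr C" "Dom C f = Dom C m" "Dom C h = Cod C m"
    "Dom C g = Cod C f" "Cod C h = Cod C g" "Comp C h m = Comp C g f"
  using assms unfolding is_pushout_def by blast+

lemma pushout_sym:
  assumes "is_pushout C m f h g"
  shows "is_pushout C f m g h"
  unfolding is_pushout_def
proof (intro conjI ballI impI)
  note [simp] = pushout_Arr[OF assms]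
  fix x y
  assume "x \<in> Arr C" "y \<in> Arr C"
    and "Dom C x = Cod C f \<and> Dom C y = Cod C m \<and> Cod C x = Cod C y \<and> Comp C x f = Comp C y m"
  then have xy: "y \<in> Arr C" "x \<in> Arr C" "Dom C y = Cod C m" "Dom C x = Cod C f"
    "Cod C y = Cod C x" "Comp C y m = Comp C x f" by auto
  then have "\<exists>!u. u \<in> homs C (Cod C g) (Cod C y) \<and> Comp C u h = y \<and> Comp C u g = x"
    using assms unfolding is_pushout_def by blast
  then obtain u where "u \<in> homs C (Cod C g) (Cod C y)" "Comp C u h = y" "Comp C u g = x"
    and "\<And>v. v \<in> homs C (Cod C g) (Cod C y) \<Longrightarrow> Comp C v h = y \<Longrightarrow> Comp C v g = x \<Longrightarrow> v = u"
    by blast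
  then show "\<exists>!u. u \<in> homs C (Cod C h) (Cod C x) \<and> Comp C u g = x \<and> Comp C u h = y"
    unfolding pushout_Arr(8)[OF assms] xy(5)[symmetric] by (intro ex1I[of _ u] conjI) blast+
qed (simp_all add: pushout_Arr[OF assms])

lemma pushoutE:
  assumes "is_pushout C m f h g" "x \<in> Arr C" "y \<in> Arr C" "Dom C x = Cod C m" "Dom C y = Cod C f"
    "Cod C x = Cod C y" "Comp C x m = Comp C y f"
  obtains u where "u \<in> Arr C" "Dom C u = Cod C g" "Cod C u = Cod C y" "Comp C u h = x" "Comp C u g = y"
proof -
  have "\<exists>!u. u \<in> homs C (Cod C g) (Cod C x) \<and> Comp C u h = x \<and> Comp C u g = y"
    using assms unfolding is_pushout_def by blast
  then show thesis using that assms(6) by (auto simp: homs_def)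
qed

context abelian_category
begin

lemma pushout_cancel:
  assumes "is_pushout C m f h g" "u \<in> Arr C" "v \<in> Arr C" "Dom C u = Cod C g" "Dom C v = Cod C g"
    "Cod C u = Cod C v" "u \<cdot> h = v \<cdot> h" "u \<cdot> g = v \<cdot> g"
  shows "u = v"
proof -
  note [simp] = pushout_Arr[OF assms(1)] assms(2-6)
  have "(u \<cdot> h) \<cdot> m = (u \<cdot> g) \<cdot> f" "u \<cdot> h \<in> Arr C" "u \<cdot> g \<in> Arr C" "Dom C (u \<cdot> h) = Cod C m"
    "Dom C (u \<cdot> g) = Cod C f" "Cod C (u \<cdot> h) = Cod C (u \<cdot> g)" by (simp_all add: assoc)
  then have "\<exists>!w. w \<in> homs C (Cod C g) (Cod C (u \<cdot> h)) \<and> w \<cdot> h = u \<cdot> h \<and> w \<cdot> g = u \<cdot> g"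
    using assms(1) unfolding is_pushout_def by blast
  moreover have "u \<in> homs C (Cod C g) (Cod C (u \<cdot> h))" "v \<in> homs C (Cod C g) (Cod C (u \<cdot> h))"
    by (auto simp: homs_iff)
  ultimately show ?thesis using assms(7,8) by metis
qed

text \<open>The pushout is the cokernel \<open>c\<close> of \<open>t = (m, -f)\<close>. Because \<open>m\<close> is monic, so is \<open>t\<close>, hence \<open>t\<close> is the
  kernel of \<open>c\<close>: an element of \<open>Cod m\<close> or \<open>Cod f\<close> which dies in the pushout comes from \<open>Dom m\<close>. This
  yields the statements on kernels.\<close>

lemma ex_pushout_of_monic:
  assumes m: "monic C m" and [simp]: "f \<in> Arr C" "Dom C f = Dom C m"
  obtains h g where "is_pushout C m f h g" "monic C g"
    "\<And>k. is_kernel C k f \<Longrightarrow> is_kernel C (m \<cdot> k) h"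
proof -
  have [simp]: "m \<in> Arr C" using m by (rule monic_Arr)
  obtain S i1 i2 p1 p2 where [simp]:
    "S \<in> Obj C" "i1 \<in> Arr C" "i2 \<in> Arr C" "p1 \<in> Arr C" "p2 \<in> Arr C"
    "Dom C i1 = Cod C m" "Cod C i1 = S" "Dom C i2 = Cod C f" "Cod C i2 = S"
    "Dom C p1 = S" "Cod C p1 = Cod C m" "Dom C p2 = S" "Cod C p2 = Cod C f" and
    pi: "p1 \<cdot> i1 = Ident C (Cod C m)" "p2 \<cdot> i2 = Ident C (Cod C f)"
    "p1 \<cdot> i2 = Zero C (Cod C f) (Cod C m)" "p2 \<cdot> i1 = Zero C (Cod C m) (Cod C f)" and
    sum: "(i1 \<cdot> p1) \<oplus> (i2 \<cdot> p2) = Ident C S"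
    using biproductE[OF Cod_Obj[OF \<open>m \<in> Arr C\<close>] Cod_Obj[OF \<open>f \<in> Arr C\<close>]] by blast
  define t where "t = (i1 \<cdot> m) \<oplus> neg C (i2 \<cdot> f)"
  have [simp]: "t \<in> Arr C" "Dom C t = Dom C m" "Cod C t = S" by (auto simp: t_def)
  have p1t: "p1 \<cdot> t = m" unfolding t_def
    by (subst distrib_left) (auto simp: reassoc[OF pi(1)] reassoc[OF pi(3)])
  have p2t: "p2 \<cdot> t = neg C f" unfolding t_def
    by (subst distrib_left) (auto simp: reassoc[OF pi(2)] reassoc[OF pi(4)])
  have mt: "monic C t"
  proof (rule monicI)
    fix x assume [simp]: "x \<in> Arr C" "Cod C x = Dom C t" "t \<cdot> x = Zero C (Dom C x) (Cod C t)"
    have "m \<cdot> x = p1 \<cdot> (t \<cdot> x)" by (subst reassoc[OF p1t]) auto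
    then show "x = Zero C (Dom C x) (Dom C t)" using monicD[OF m, of x] by simp
  qed simp
  obtain c where c: "ses C t c" using monic_ex_ses[OF mt] by blast
  then have kt: "is_kernel C t c" and ct: "is_cokernel C c t" by (auto simp: ses_def)
  note [simp] = is_cokernel_Arr(1)[OF ct] is_cokernel_Arr(3)[OF ct, simplified]
  define h where "h = c \<cdot> i1"
  define g where "g = c \<cdot> i2"
  have [simp]: "h \<in> Arr C" "g \<in> Arr C" "Dom C h = Cod C m" "Dom C g = Cod C f"
    "Cod C h = Cod C c" "Cod C g = Cod C c" by (auto simp: h_def g_def)
  have "c \<cdot> t = (h \<cdot> m) \<oplus> neg C (g \<cdot> f)"
    unfolding t_def h_def g_def by (subst distrib_left) (auto simp: assoc)
  then have "(h \<cdot> m) \<oplus> neg C (g \<cdot> f) = Zero C (Dom C m) (Cod C c)"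
    using is_cokernel_Arr(4)[OF ct] by simp
  then have hm: "h \<cdot> m = g \<cdot> f"
    using eq_negI[of "h \<cdot> m" "neg C (g \<cdot> f)"] by simp
  have po: "is_pushout C m f h g"
    unfolding is_pushout_def
  proof (intro conjI ballI impI)
    fix x y assume [simp]: "x \<in> Arr C" "y \<in> Arr C"
    assume "Dom C x = Cod C m \<and> Dom C y = Cod C f \<and> Cod C x = Cod C y \<and> x \<cdot> m = y \<cdot> f"
    then have [simp]: "Dom C x = Cod C m" "Dom C y = Cod C f" "Cod C x = Cod C y"
      and e: "x \<cdot> m = y \<cdot> f" by auto
    define z where "z = (x \<cdot> p1) \<oplus> (y \<cdot> p2)"
    have [simp]: "z \<in> Arr C" "Dom C z = S" "Cod C z = Cod C y" by (auto simp: z_def)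
    have "z \<cdot> t = (x \<cdot> m) \<oplus> neg C (y \<cdot> f)"
      unfolding z_def by (subst distrib_right) (auto simp: assoc p1t p2t)
    then have "z \<cdot> t = Zero C (Dom C t) (Cod C z)" by (simp add: e)
    then obtain u where [simp]: "u \<in> Arr C" "Cod C u = Cod C y" "Dom C u = Cod C c" and u: "u \<cdot> c = z"
      using is_cokernelE[OF ct, of z] by auto
    have z1: "z \<cdot> i1 = x" and z2: "z \<cdot> i2 = y"
      unfolding z_def by (subst distrib_right; auto simp: assoc pi)+
    show "\<exists>!u. u \<in> homs C (Cod C g) (Cod C x) \<and> u \<cdot> h = x \<and> u \<cdot> g = y"
    proof (intro ex1I conjI)
      show "u \<in> homs C (Cod C g) (Cod C x)" by (simp add: homs_iff)
      show "u \<cdot> h = x" "u \<cdot> g = y" unfolding h_def g_def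
        by (auto simp: reassoc[OF u] z1 z2)
      fix v assume v: "v \<in> homs C (Cod C g) (Cod C x) \<and> v \<cdot> h = x \<and> v \<cdot> g = y"
      then have [simp]: "v \<in> Arr C" "Cod C v = Cod C y" "Dom C v = Cod C c" by (auto simp: homs_iff)
      have "v \<cdot> c = (v \<cdot> c) \<cdot> ((i1 \<cdot> p1) \<oplus> (i2 \<cdot> p2))" by (simp add: sum)
      also have "\<dots> = ((v \<cdot> h) \<cdot> p1) \<oplus> ((v \<cdot> g) \<cdot> p2)"
        unfolding h_def g_def by (subst distrib_left) (auto simp: assoc)
      also have "\<dots> = u \<cdot> c" using v u z_def by simp
      finally show "v = u" using epic_cancel[OF cokernel_epic[OF ct], of v u] by simp
    qed
  qed (use hm in auto)
  have factor: "\<exists>y \<in> Arr C. Dom C y = Dom C x \<and> Cod C y = Dom C m \<and> t \<cdot> y = x"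
    if "x \<in> Arr C" "Cod C x = S" "c \<cdot> x = Zero C (Dom C x) (Cod C c)" for x
    using is_kernelE[OF kt, of x] that by auto
  have mg: "monic C g"
  proof (rule monicI)
    fix x assume [simp]: "x \<in> Arr C" "Cod C x = Dom C g"
    assume "g \<cdot> x = Zero C (Dom C x) (Cod C g)"
    then have "c \<cdot> (i2 \<cdot> x) = Zero C (Dom C x) (Cod C c)" by (simp add: g_def assoc)
    then obtain y where [simp]: "y \<in> Arr C" "Dom C y = Dom C x" "Cod C y = Dom C m"
      and y: "t \<cdot> y = i2 \<cdot> x" using factor[of "i2 \<cdot> x"] by auto
    have "m \<cdot> y = p1 \<cdot> (t \<cdot> y)" by (subst reassoc[OF p1t]) auto
    also have "\<dots> = Zero C (Dom C y) (Cod C m)" unfolding y by (subst reassoc[OF pi(3)]) auto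
    finally have y0: "y = Zero C (Dom C x) (Dom C m)" using monicD[OF m, of y] by simp
    have "x = p2 \<cdot> (i2 \<cdot> x)" by (subst reassoc[OF pi(2)]) auto
    then show "x = Zero C (Dom C x) (Dom C g)" unfolding y[symmetric] y0 by simp
  qed simp
  have "is_kernel C (m \<cdot> k) h" if k: "is_kernel C k f" for k
  proof (rule is_kernelI)
    note [simp] = is_kernel_Arr[OF k]
    show "monic C (m \<cdot> k)" using monic_Comp[OF kernel_monic[OF k] m] by simp
    have "h \<cdot> (m \<cdot> k) = g \<cdot> (f \<cdot> k)" by (subst reassoc[OF hm]) (auto simp: assoc)
    then show "h \<cdot> (m \<cdot> k) = Zero C (Dom C (m \<cdot> k)) (Cod C h)" by simp
    fix x assume [simp]: "x \<in> Arr C" "Cod C x = Dom C h"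
    assume "h \<cdot> x = Zero C (Dom C x) (Cod C h)"
    then have "c \<cdot> (i1 \<cdot> x) = Zero C (Dom C x) (Cod C c)" by (simp add: h_def assoc)
    then obtain y where [simp]: "y \<in> Arr C" "Dom C y = Dom C x" "Cod C y = Dom C m"
      and y: "t \<cdot> y = i1 \<cdot> x" using factor[of "i1 \<cdot> x"] by auto
    have "m \<cdot> y = p1 \<cdot> (t \<cdot> y)" by (subst reassoc[OF p1t]) auto
    also have "\<dots> = x" unfolding y by (subst reassoc[OF pi(1)]) auto
    finally have my: "m \<cdot> y = x" .
    have "neg C (f \<cdot> y) = p2 \<cdot> (t \<cdot> y)" by (subst reassoc[OF p2t]) auto
    also have "\<dots> = Zero C (Dom C x) (Cod C f)" unfolding y by (subst reassoc[OF pi(4)]) auto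
    finally have "neg C (neg C (f \<cdot> y)) = neg C (Zero C (Dom C x) (Cod C f))" by simp
    then have "f \<cdot> y = Zero C (Dom C x) (Cod C f)" by simp
    then obtain u where [simp]: "u \<in> Arr C" "Dom C u = Dom C x" "Cod C u = Dom C k" and "k \<cdot> u = y"
      using is_kernelE[OF k, of y] by auto
    then show "\<exists>u \<in> Arr C. Dom C u = Dom C x \<and> Cod C u = Dom C (m \<cdot> k) \<and> (m \<cdot> k) \<cdot> u = x"
      using my by (intro bexI[of _ u]) (auto simp: assoc)
  qed (use is_kernel_Arr[OF k] in auto)
  then show thesis using that po mg by blast
qed

text \<open>The kernel of \<open>h\<close> is that of \<open>f\<close> followed by \<open>m\<close>, hence zero if \<open>f\<close> is monic.\<close>

lemma ex_pushout_of_monics: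
  assumes m: "monic C m" and f: "monic C f" and D: "Dom C f = Dom C m"
  obtains h g where "is_pushout C m f h g" "monic C g" "monic C h"
proof -
  note [simp] = monic_Arr[OF m] monic_Arr[OF f] D
  obtain h g where po: "is_pushout C m f h g" and g: "monic C g"
    and ker: "\<And>k. is_kernel C k f \<Longrightarrow> is_kernel C (m \<cdot> k) h"
    using ex_pushout_of_monic[OF m monic_Arr[OF f] D] by blast
  obtain k where k: "is_kernel C k f" using ex_kernel[of f] by auto
  note [simp] = pushout_Arr[OF po] is_kernel_Arr[OF k]
  have k0: "k = Zero C (Dom C k) (Dom C m)" using monicD[OF f, of k] by simp
  have "monic C h"
  proof (rule monicI)
    fix x assume [simp]: "x \<in> Arr C" "Cod C x = Dom C h" and "h \<cdot> x = Zero C (Dom C x) (Cod C h)"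
    then obtain u where [simp]: "u \<in> Arr C" "Dom C u = Dom C x" "Cod C u = Dom C k" and u: "m \<cdot> k \<cdot> u = x"
      using is_kernelE[OF ker[OF k], of x] by auto
    have "m \<cdot> k = Zero C (Dom C k) (Cod C m)" by (subst k0) simp
    then show "x = Zero C (Dom C x) (Dom C h)" unfolding u[symmetric] by simp
  qed simp
  then show thesis using that po g by blast
qed

text \<open>By the universal property, arrows out of the pushout that vanish on \<open>g\<close> are the same as arrows
  out of \<open>Cod m\<close> that vanish on \<open>m\<close>.\<close>

lemma pushout_cokernel:
  assumes po: "is_pushout C m f h g" and n: "is_cokernel C n m"
  obtains w where "w \<in> Arr C" "Dom C w = Cod C g" "Cod C w = Cod C n" "w \<cdot> h = n" "is_cokernel C w g"
proof -
  note [simp] = pushout_Arr[OF po] is_cokernel_Arr[OF n]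
  obtain w where [simp]: "w \<in> Arr C" "Dom C w = Cod C g" "Cod C w = Cod C n"
    and w: "w \<cdot> h = n" "w \<cdot> g = Zero C (Cod C f) (Cod C n)"
    using pushoutE[OF po, of n "Zero C (Cod C f) (Cod C n)"] by auto
  have "is_cokernel C w g"
  proof (rule is_cokernelI)
    show "epic C w"
      unfolding epic_def
    proof (intro conjI allI ballI impI)
      fix W x y assume "x \<in> homs C (Cod C w) W" "y \<in> homs C (Cod C w) W" and xy: "x \<cdot> w = y \<cdot> w"
      then have [simp]: "x \<in> Arr C" "y \<in> Arr C" "Dom C x = Cod C n" "Dom C y = Cod C n"
        and [simp]: "Cod C x = W" "Cod C y = W" by (auto simp: homs_iff)
      have "x \<cdot> n = (x \<cdot> w) \<cdot> h" by (simp add: assoc w)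
      also have "\<dots> = y \<cdot> n" unfolding xy by (simp add: assoc w)
      finally show "x = y" using epic_cancel[OF cokernel_epic[OF n], of x y] by simp
    qed simp
    fix x assume [simp]: "x \<in> Arr C" "Dom C x = Cod C g" and x: "x \<cdot> g = Zero C (Dom C g) (Cod C x)"
    have "(x \<cdot> h) \<cdot> m = (x \<cdot> g) \<cdot> f" by (simp add: assoc)
    then have "(x \<cdot> h) \<cdot> m = Zero C (Dom C m) (Cod C x)" by (simp add: x)
    then obtain u where [simp]: "u \<in> Arr C" "Cod C u = Cod C x" "Dom C u = Cod C n"
      and u: "u \<cdot> n = x \<cdot> h" using is_cokernelE[OF n, of "x \<cdot> h"] by auto
    have "u \<cdot> w = x"
      by (rule pushout_cancel[OF po]) (auto simp: assoc w u x)
    then show "\<exists>u \<in> Arr C. Cod C u = Cod C x \<and> Dom C u = Cod C w \<and> u \<cdot> w = x"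
      by (intro bexI[of _ u]) auto
  qed (simp_all add: w)
  then show thesis using that[of w] w by simp
qed

text \<open>The third isomorphism theorem, \<open>(Q/V)/(P/V) = Q/P\<close> for \<open>V\<close> the image of \<open>g\<close>. The cokernel of
  \<open>m \<cdot> g\<close> is the pushout of \<open>m\<close> along the cokernel of \<open>g\<close>, so the results on pushouts of
  monomorphisms apply.\<close>

lemma cokernel_of_Comp_sequence:
  assumes m: "monic C m" and d: "is_cokernel C d g" and [simp]: "Cod C g = Dom C m"
    and n: "is_cokernel C n m"
  obtains m' d' n' where "is_cokernel C d' (m \<cdot> g)" "ses C m' n'" "Dom C m' = Cod C d"
    "Cod C m' = Cod C d'" "Cod C n' = Cod C n"
proof -
  note [simp] = is_cokernel_Arr[OF d] is_cokernel_Arr[OF n]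
  have "d \<in> Arr C" "Dom C d = Dom C m" by auto
  then obtain h m' where po: "is_pushout C m d h m'" and m': "monic C m'"
    using ex_pushout_of_monic[OF m] by blast
  note [simp] = pushout_Arr[OF po]
  have "is_cokernel C h (m \<cdot> g)"
  proof (rule is_cokernelI)
    show "epic C h"
      unfolding epic_def
    proof (intro conjI allI ballI impI)
      fix W x y assume "x \<in> homs C (Cod C h) W" "y \<in> homs C (Cod C h) W" and xy: "x \<cdot> h = y \<cdot> h"
      then have [simp]: "x \<in> Arr C" "y \<in> Arr C" "Dom C x = Cod C m'" "Dom C y = Cod C m'"
        and [simp]: "Cod C x = W" "Cod C y = W" by (auto simp: homs_iff)
      have "(x \<cdot> m') \<cdot> d = (x \<cdot> h) \<cdot> m" by (simp add: assoc)
      also have "\<dots> = (y \<cdot> m') \<cdot> d" unfolding xy by (simp add: assoc)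
      finally have "x \<cdot> m' = y \<cdot> m'"
        using epic_cancel[OF cokernel_epic[OF d], of "x \<cdot> m'" "y \<cdot> m'"] by simp
      then show "x = y" using pushout_cancel[OF po, of x y] xy by simp
    qed simp
    have "h \<cdot> (m \<cdot> g) = m' \<cdot> (d \<cdot> g)" by (subst reassoc[OF pushout_Arr(9)[OF po]]) (auto simp: assoc)
    then show "h \<cdot> (m \<cdot> g) = Zero C (Dom C (m \<cdot> g)) (Cod C h)" by simp
    fix x assume [simp]: "x \<in> Arr C" "Dom C x = Cod C (m \<cdot> g)"
      and x: "x \<cdot> (m \<cdot> g) = Zero C (Dom C (m \<cdot> g)) (Cod C x)"
    then have "(x \<cdot> m) \<cdot> g = Zero C (Dom C g) (Cod C x)" by (simp add: assoc)
    then obtain u where [simp]: "u \<in> Arr C" "Cod C u = Cod C x" "Dom C u = Cod C d"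
      and u: "u \<cdot> d = x \<cdot> m" using is_cokernelE[OF d, of "x \<cdot> m"] by auto
    obtain v where "v \<in> Arr C" "Dom C v = Cod C m'" "Cod C v = Cod C x" "v \<cdot> h = x"
      using pushoutE[OF po, of x u] u by auto
    then show "\<exists>u \<in> Arr C. Cod C u = Cod C x \<and> Dom C u = Cod C h \<and> u \<cdot> h = x" by auto
  qed auto
  moreover obtain w where "Cod C w = Cod C n" "is_cokernel C w m'"
    using pushout_cokernel[OF po n] by blast
  ultimately show thesis using that[of h m' w] ses_cokernelI[OF _ m'] by simp
qed

end

section \<open>Blended extensions and the vanishing of the second Ext groups\<close>

text \<open>Blended extensions are Grothendieck's extensions panachees: \<open>Cod j\<close> is an extension of \<open>Dom c\<close> by
  \<open>Dom a\<close> that contains \<open>Cod a\<close> as the preimage of the image of \<open>b\<close>. Listing both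
  short exact sequences makes the definition self-dual.\<close>

definition blended :: "('o, 'm, 'z) ab_cat_scheme \<Rightarrow> 'm \<Rightarrow> 'm \<Rightarrow> 'm \<Rightarrow> bool"
  where "blended C a b c \<longleftrightarrow> (\<exists>j \<in> Arr C. \<exists>q \<in> Arr C. Dom C j = Cod C a \<and> Cod C j = Dom C q \<and>
    Cod C q = Dom C c \<and> Comp C q j = b \<and> ses C (Comp C j a) q \<and> ses C j (Comp C c q))"

lemma blended_opposite [simp]: "blended (opposite C) c b a = blended C a b c"
  unfolding blended_def opposite_simps ses_opposite by (rule iffI; metis)

context abelian_category
begin

text \<open>One of the two exact sequences suffices. If \<open>j \<cdot> x = 0\<close>, then \<open>b \<cdot> x = 0\<close>, so \<open>x\<close> comes from the kernel
  \<open>a\<close> of \<open>b\<close>, on which \<open>j\<close> is injective. An arrow that vanishes on \<open>j\<close> vanishes on \<open>j \<cdot> a\<close>, hence factors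
  through \<open>q\<close>, and the factor vanishes on \<open>b = q \<cdot> j\<close>, hence factors through \<open>c\<close>.\<close>

lemma blendedI:
  assumes a: "is_kernel C a b" and c: "is_cokernel C c b" and [simp]: "j \<in> Arr C" "q \<in> Arr C"
    "Cod C j = Dom C q" and qj: "q \<cdot> j = b" and s: "ses C (j \<cdot> a) q"
  shows "blended C a b c"
proof -
  note [simp] = is_kernel_Arr[OF a] is_cokernel_Arr[OF c]
  have k: "is_kernel C (j \<cdot> a) q" and q: "is_cokernel C q (j \<cdot> a)" using s by (auto simp: ses_def)
  have D [simp]: "Dom C j = Dom C b" "Cod C q = Cod C b" unfolding qj[symmetric] by auto
  have "ses C j (c \<cdot> q)"
  proof (rule ses_cokernelI)
    show "monic C j"
    proof (rule monicI)
      fix x assume [simp]: "x \<in> Arr C" "Cod C x = Dom C j"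
        and x: "j \<cdot> x = Zero C (Dom C x) (Cod C j)"
      have "b \<cdot> x = q \<cdot> (j \<cdot> x)" by (subst reassoc[OF qj]) auto
      then have "b \<cdot> x = Zero C (Dom C x) (Cod C b)" unfolding x by simp
      then obtain y where [simp]: "y \<in> Arr C" "Dom C y = Dom C x" "Cod C y = Dom C a"
        and y: "a \<cdot> y = x" using is_kernelE[OF a, of x] by auto
      have "(j \<cdot> a) \<cdot> y = Zero C (Dom C y) (Cod C (j \<cdot> a))" using x y by (simp add: assoc)
      then have "y = Zero C (Dom C x) (Dom C a)" using monicD[OF kernel_monic[OF k], of y] by simp
      then have "a \<cdot> y = Zero C (Dom C x) (Dom C b)" by simp
      then show "x = Zero C (Dom C x) (Dom C j)" unfolding y by simp
    qed simp
    show "is_cokernel C (c \<cdot> q) j"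
    proof (rule is_cokernelI)
      show "epic C (c \<cdot> q)" by (rule epic_Comp[OF cokernel_epic[OF q] cokernel_epic[OF c]]) simp
      show "(c \<cdot> q) \<cdot> j = Zero C (Dom C j) (Cod C (c \<cdot> q))" by (simp add: assoc qj)
      fix x assume [simp]: "x \<in> Arr C" "Dom C x = Cod C j"
        and x: "x \<cdot> j = Zero C (Dom C j) (Cod C x)"
      have "x \<cdot> (j \<cdot> a) = Zero C (Dom C (j \<cdot> a)) (Cod C x)" by (subst reassoc[OF x]) auto
      then obtain u where [simp]: "u \<in> Arr C" "Cod C u = Cod C x" "Dom C u = Cod C b"
        and u: "u \<cdot> q = x" using is_cokernelE[OF q, of x] by auto
      have "u \<cdot> b = x \<cdot> j" unfolding qj[symmetric] by (subst reassoc[OF u]) auto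
      then have "u \<cdot> b = Zero C (Dom C b) (Cod C u)" by (simp add: x)
      then obtain w where [simp]: "w \<in> Arr C" "Cod C w = Cod C x" "Dom C w = Cod C c"
        and w: "w \<cdot> c = u" using is_cokernelE[OF c, of u] by auto
      have "w \<cdot> (c \<cdot> q) = x" by (subst reassoc[OF w]) (auto simp: u)
      then show "\<exists>u \<in> Arr C. Cod C u = Cod C x \<and> Dom C u = Cod C (c \<cdot> q) \<and> u \<cdot> (c \<cdot> q) = x"
        by (intro bexI[of _ w]) auto
    qed auto
  qed
  then show ?thesis unfolding blended_def using qj s by (intro bexI[of _ j] bexI[of _ q]) simp_all
qed

text \<open>The extension \<open>q'\<close> of \<open>Cod b'\<close> by \<open>Dom a'\<close> is pulled back along \<open>v\<close>; this does not change its kernel.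
  The arrows \<open>j' \<cdot> u\<close> and \<open>b\<close> agree over \<open>Cod b'\<close> and so define the embedding into the pullback.\<close>

lemma blended_pullback:
  assumes a: "is_kernel C a b" and c: "is_cokernel C c b" and a': "is_kernel C a' b'"
    and [simp]: "u \<in> Arr C" "v \<in> Arr C" "Dom C u = Cod C a" "Cod C u = Cod C a'"
      "Dom C v = Cod C b" "Cod C v = Cod C b'"
    and ua: "u \<cdot> a = a'" and vb: "v \<cdot> b = b' \<cdot> u"
    and bl: "blended C a' b' c'"
  shows "blended C a b c"
proof -
  note [simp] = is_kernel_Arr[OF a] is_kernel_Arr[OF a']
  obtain j' q' where [simp]: "j' \<in> Arr C" "q' \<in> Arr C" "Dom C j' = Cod C a'" "Cod C j' = Dom C q'"
    and qj': "q' \<cdot> j' = b'" and s: "ses C (j' \<cdot> a') q'"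
    using bl unfolding blended_def by blast
  have [simp]: "Cod C q' = Cod C b'" unfolding qj'[symmetric] by simp
  have k: "is_kernel C (j' \<cdot> a') q'" and ep: "epic C q'"
    using s cokernel_epic by (auto simp: ses_def)
  interpret op: abelian_category "opposite C" by (rule abelian_opposite)
  have "monic (opposite C) q'" "v \<in> Arr (opposite C)" "Dom (opposite C) v = Dom (opposite C) q'"
    using ep by simp_all
  then obtain h g where po: "is_pushout (opposite C) q' v h g" and "monic (opposite C) g"
    using op.ex_pushout_of_monic by blast
  then have g: "epic C g" by simp
  note [simp] = pushout_Arr[OF po, simplified]
  have "is_cokernel (opposite C) (j' \<cdot> a') q'" using k by simp
  then obtain w where "w \<in> Arr (opposite C)" "Dom (opposite C) w = Cod (opposite C) g"
    "Cod (opposite C) w = Cod (opposite C) (j' \<cdot> a')" "Comp (opposite C) w h = j' \<cdot> a'"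
    "is_cokernel (opposite C) w g"
    using op.pushout_cokernel[OF po] by blast
  then have [simp]: "w \<in> Arr C" "Cod C w = Dom C g" "Dom C w = Dom C a'"
    and hw: "h \<cdot> w = j' \<cdot> a'" and w: "is_kernel C w g"
    by auto
  have [simp]: "Dom C a' = Dom C a" unfolding ua[symmetric] by simp
  have "q' \<cdot> (j' \<cdot> u) = v \<cdot> b" by (subst reassoc[OF qj']) (auto simp: vb)
  then have "j' \<cdot> u \<in> Arr (opposite C)" "b \<in> Arr (opposite C)"
    "Dom (opposite C) (j' \<cdot> u) = Cod (opposite C) q'" "Dom (opposite C) b = Cod (opposite C) v"
    "Cod (opposite C) (j' \<cdot> u) = Cod (opposite C) b"
    "Comp (opposite C) (j' \<cdot> u) q' = Comp (opposite C) b v"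
    by simp_all
  then obtain j where "j \<in> Arr (opposite C)" "Dom (opposite C) j = Cod (opposite C) g"
    "Cod (opposite C) j = Cod (opposite C) b" "Comp (opposite C) j h = j' \<cdot> u"
    "Comp (opposite C) j g = b"
    using pushoutE[OF po] by blast
  then have [simp]: "j \<in> Arr C" "Cod C j = Dom C g" "Dom C j = Dom C b"
    and hj: "h \<cdot> j = j' \<cdot> u" and gj: "g \<cdot> j = b"
    by simp_all
  have "h \<cdot> w = h \<cdot> (j \<cdot> a)" by (subst reassoc[OF hj]) (auto simp: assoc hw ua)
  moreover have "g \<cdot> w = g \<cdot> (j \<cdot> a)"
    by (subst reassoc[OF gj]) (use is_kernel_Arr(4)[OF w] in auto)
  ultimately have "w = j \<cdot> a"
    using op.pushout_cancel[OF po, of w "j \<cdot> a"] by simp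
  then have "ses C (j \<cdot> a) g" using ses_kernelI[OF w g] by simp
  then show ?thesis using blendedI[OF a c, of j g] gj by simp
qed

text \<open>The dual statement, for morphisms in the other direction.\<close>

lemma blended_pushout:
  assumes "is_kernel C a' b'" "is_cokernel C c' b'" "is_cokernel C c b" "is_kernel C a b"
    and "u \<in> Arr C" "v \<in> Arr C" "Dom C u = Cod C a" "Cod C u = Cod C a'"
      "Dom C v = Cod C b" "Cod C v = Cod C b'"
    and "c' \<cdot> v = c" "v \<cdot> b = b' \<cdot> u" "blended C a b c"
  shows "blended C a' b' c'"
proof -
  note [simp] = is_kernel_Arr[OF assms(1)] is_kernel_Arr[OF assms(4)]
    is_cokernel_Arr[OF assms(2)] is_cokernel_Arr[OF assms(3)]
  show ?thesis
    using abelian_category.blended_pullback[OF abelian_opposite, of c' b' a' c b v u a] assms by simp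
qed

text \<open>The biproduct of the two ends is a blended extension of the trivial two-extension.\<close>

lemma blended_zero:
  assumes "X \<in> Obj C" "Y \<in> Obj C"
  shows "blended C (Ident C Y) (Zero C Y X) (Ident C X)"
proof -
  obtain S i1 i2 p1 p2 where [simp]: "S \<in> Obj C" "i1 \<in> Arr C" "i2 \<in> Arr C" "p1 \<in> Arr C" "p2 \<in> Arr C"
    "Dom C i1 = Y" "Cod C i1 = S" "Dom C i2 = X" "Cod C i2 = S"
    "Dom C p1 = S" "Cod C p1 = Y" "Dom C p2 = S" "Cod C p2 = X" and
    e: "p1 \<cdot> i1 = Ident C Y" "p2 \<cdot> i2 = Ident C X" "p1 \<cdot> i2 = Zero C X Y" "p2 \<cdot> i1 = Zero C Y X" and
    sum: "(i1 \<cdot> p1) \<oplus> (i2 \<cdot> p2) = Ident C S"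
    using biproductE[OF assms(2,1)] by blast
  note [simp] = assms
  have "ses C i1 p2"
  proof (rule ses_kernelI)
    show "is_kernel C i1 p2"
    proof (rule is_kernelI)
      show "monic C i1"
      proof (rule monicI)
        fix x assume [simp]: "x \<in> Arr C" "Cod C x = Dom C i1"
          and x: "i1 \<cdot> x = Zero C (Dom C x) (Cod C i1)"
        have "x = p1 \<cdot> (i1 \<cdot> x)" by (subst reassoc[OF e(1)]) auto
        then show "x = Zero C (Dom C x) (Dom C i1)" unfolding x by simp
      qed simp
      fix x assume [simp]: "x \<in> Arr C" "Cod C x = Dom C p2"
        and x: "p2 \<cdot> x = Zero C (Dom C x) (Cod C p2)"
      have "x = ((i1 \<cdot> p1) \<oplus> (i2 \<cdot> p2)) \<cdot> x" by (simp add: sum)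
      also have "\<dots> = i1 \<cdot> (p1 \<cdot> x)" by (subst distrib_right) (auto simp: assoc x)
      finally show "\<exists>u \<in> Arr C. Dom C u = Dom C x \<and> Cod C u = Dom C i1 \<and> i1 \<cdot> u = x"
        by (intro bexI[of _ "p1 \<cdot> x"]) auto
    qed (auto simp: e)
    show "epic C p2"
      unfolding epic_def
    proof (intro conjI allI ballI impI)
      fix W x y assume "x \<in> homs C (Cod C p2) W" "y \<in> homs C (Cod C p2) W" and xy: "x \<cdot> p2 = y \<cdot> p2"
      then have [simp]: "x \<in> Arr C" "y \<in> Arr C" "Dom C x = X" "Dom C y = X" by (auto simp: homs_iff)
      have "x = (x \<cdot> p2) \<cdot> i2" by (simp add: assoc e)
      also have "\<dots> = y" unfolding xy by (simp add: assoc e)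
      finally show "x = y" .
    qed simp
  qed
  moreover have "is_kernel C (Ident C Y) (Zero C Y X)"
    by (rule is_kernelI) (auto intro!: monicI)
  moreover have "is_cokernel C (Ident C X) (Zero C Y X)"
    by (rule is_cokernelI) (auto simp: epic_def homs_iff)
  ultimately show ?thesis by (intro blendedI[of _ _ _ i1 p2]) (auto simp: e)
qed

end

text \<open>Heredity connects the two-extension \<open>(a, b, c)\<close> with the trivial one by a zigzag of morphisms, and
  the existence of a blended extension is transported along each of them.\<close>

lemma (in hereditary_abelian_category) ex_blended:
  assumes "is_kernel C a b" "is_cokernel C c b"
  shows "blended C a b c"
proof -
  let ?X = "Cod C c" and ?Y = "Dom C a"
  let ?T = "two_extension_map C ?X ?Y"
  let ?z = "(Ident C ?Y, Zero C ?Y ?X, Ident C ?X)"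
  have XY: "?X \<in> Obj C" "?Y \<in> Obj C"
    using is_kernel_Arr[OF assms(1)] is_cokernel_Arr[OF assms(2)] by auto
  have "(a, b, c) \<in> two_extensions C ?X ?Y" using assms by (simp add: two_extensions_iff)
  then have "yoneda_class C ?X ?Y (a, b, c) = Ext2_zero C ?X ?Y"
    using hereditary[OF XY] unfolding Ext2_def by blast
  then have "equivclp ?T ?z (a, b, c)"
    unfolding yoneda_class_def Ext2_zero_def by (metis mem_Collect_eq equivclp_refl)
  then have "case (a, b, c) of (a, b, c) \<Rightarrow> blended C a b c"
  proof (induction rule: equivclp_induct)
    case base
    then show ?case using blended_zero[OF XY] by simp
  next
    case (step e e')
    obtain a b c a' b' c' where e: "e = (a, b, c)" "e' = (a', b', c')" by (cases e, cases e') auto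
    have bl: "blended C a b c" using step(3) e by simp
    have "blended C a' b' c'"
      using step(2)
    proof
      assume "?T e e'"
      then obtain u v where "u \<in> homs C (Cod C a) (Cod C a')" "v \<in> homs C (Cod C b) (Cod C b')"
        "c' \<cdot> v = c" "v \<cdot> b = b' \<cdot> u" "is_kernel C a b" "is_kernel C a' b'" "is_cokernel C c b"
        "is_cokernel C c' b'"
        unfolding e two_extension_map_def by (auto simp: two_extensions_iff)
      then show ?thesis using bl by (intro blended_pushout[of a' b' c' c b a u v]) (auto simp: homs_iff)
    next
      assume "?T e' e"
      then obtain u v where "u \<in> homs C (Cod C a') (Cod C a)" "v \<in> homs C (Cod C b') (Cod C b)"
        "u \<cdot> a' = a" "v \<cdot> b' = b \<cdot> u" "is_kernel C a b" "is_kernel C a' b'" "is_cokernel C c' b'"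
        unfolding e two_extension_map_def by (auto simp: two_extensions_iff)
      then show ?thesis using bl by (intro blended_pullback[of a' b' c' a b u v c]) (auto simp: homs_iff)
    qed
    then show ?case using e by simp
  qed
  then show ?thesis by simp
qed

section \<open>The kernels of the arrows of a narrow subcategory\<close>

definition kernels_in :: "('o, 'm, 'z) ab_cat_scheme \<Rightarrow> 'o set \<Rightarrow> 'o set"
  where "kernels_in C N = {Dom C k | k f. is_kernel C k f \<and> Dom C f \<in> N \<and> Cod C f \<in> N}"

lemma kernels_inI:
  "is_kernel C k f \<Longrightarrow> Dom C f \<in> N \<Longrightarrow> Cod C f \<in> N \<Longrightarrow> Dom C k \<in> kernels_in C N"
  by (auto simp: kernels_in_def)

lemma closed_under_cokernelsD:
  "closed_under_cokernels C S \<Longrightarrow> is_cokernel C c f \<Longrightarrow> Dom C f \<in> S \<Longrightarrow> Cod C f \<in> S \<Longrightarrow> Cod C c \<in> S"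
  unfolding closed_under_cokernels_def is_cokernel_def homs_def by blast

lemma closed_under_kernelsD:
  "closed_under_kernels C S \<Longrightarrow> is_kernel C k f \<Longrightarrow> Dom C f \<in> S \<Longrightarrow> Cod C f \<in> S \<Longrightarrow> Dom C k \<in> S"
  unfolding closed_under_kernels_def is_kernel_def homs_def by blast

lemma (in abelian_category) closed_under_extensionsD:
  "closed_under_extensions C S \<Longrightarrow> ses C i p \<Longrightarrow> Dom C i \<in> S \<Longrightarrow> Cod C p \<in> S \<Longrightarrow> Cod C i \<in> S"
  unfolding closed_under_extensions_def short_exact_iff_ses by blast

lemma (in abelian_category) kernel_of_Comp_monic:
  assumes k: "is_kernel C k f" and m: "monic C m" and d: "Dom C m = Cod C f"
  shows "is_kernel C k (m \<cdot> f)"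
proof (rule is_kernelI)
  note [simp] = is_kernel_Arr[OF k] monic_Arr[OF m] d
  show "monic C k" by (rule kernel_monic[OF k])
  show "m \<cdot> f \<cdot> k = Zero C (Dom C k) (Cod C (m \<cdot> f))" by (simp add: assoc)
  fix x assume [simp]: "x \<in> Arr C" "Cod C x = Dom C (m \<cdot> f)"
    and x: "m \<cdot> f \<cdot> x = Zero C (Dom C x) (Cod C (m \<cdot> f))"
  then have "m \<cdot> (f \<cdot> x) = Zero C (Dom C (f \<cdot> x)) (Cod C m)" by (simp add: assoc)
  then have "f \<cdot> x = Zero C (Dom C x) (Cod C f)" using monicD[OF m, of "f \<cdot> x"] by simp
  then obtain u where "u \<in> Arr C" "Dom C u = Dom C x" "Cod C u = Dom C k" "k \<cdot> u = x"
    using is_kernelE[OF k, of x] by auto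
  then show "\<exists>u \<in> Arr C. Dom C u = Dom C x \<and> Cod C u = Dom C k \<and> k \<cdot> u = x" by blast
qed (use is_kernel_Arr[OF k] monic_Arr[OF m] d in simp_all)

lemma (in abelian_category) cokernel_of_Comp_epic:
  assumes "is_cokernel C c f" "epic C e" "Cod C e = Dom C f"
  shows "is_cokernel C c (f \<cdot> e)"
  using abelian_category.kernel_of_Comp_monic[OF abelian_opposite, of c f e] assms by simp

locale hereditary_narrow = hereditary_abelian_category +
  fixes N
  assumes subcategory: "subcategory C N"
    and extensions: "closed_under_extensions C N"
    and cokernels: "closed_under_cokernels C N"
begin

lemma in_N_Obj: "X \<in> N \<Longrightarrow> X \<in> Obj C"
  using subcategory by (auto simp: subcategory_def)

lemma extension_in_N: "ses C i p \<Longrightarrow> Dom C i \<in> N \<Longrightarrow> Cod C p \<in> N \<Longrightarrow> Cod C i \<in> N"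
  using closed_under_extensionsD[OF extensions] by blast

lemma cokernel_in_N: "is_cokernel C c f \<Longrightarrow> Dom C f \<in> N \<Longrightarrow> Cod C f \<in> N \<Longrightarrow> Cod C c \<in> N"
  using closed_under_cokernelsD[OF cokernels] by blast

text \<open>A kernel of an arbitrary arrow of \<open>N\<close> is also a kernel of an epimorphism of \<open>N\<close>: the blended
  extension of the arrow is an extension of its cokernel by its domain.\<close>

lemma resolution:
  assumes "X \<in> kernels_in C N"
  obtains m n where "ses C m n" "Dom C m = X" "Cod C m \<in> N" "Cod C n \<in> N"
proof -
  obtain k f where k: "is_kernel C k f" and N: "Dom C f \<in> N" "Cod C f \<in> N" and X: "Dom C k = X"
    using assms by (auto simp: kernels_in_def)
  note [simp] = is_kernel_Arr[OF k]
  obtain c where c: "is_cokernel C c f" using ex_cokernel[of f] by auto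
  note [simp] = is_cokernel_Arr[OF c]
  obtain j q where [simp]: "j \<in> Arr C" "q \<in> Arr C" "Dom C j = Cod C k" "Cod C j = Dom C q" "Cod C q = Dom C c"
    and s1: "ses C (j \<cdot> k) q" and s2: "ses C j (c \<cdot> q)"
    using ex_blended[OF k c] unfolding blended_def by blast
  have "Cod C j \<in> N"
    using extension_in_N[OF s2] N cokernel_in_N[OF c] by simp
  then show thesis using that[OF s1] X N by simp
qed

lemma N_subset_kernels: "N \<subseteq> kernels_in C N"
proof
  fix X assume X: "X \<in> N"
  note [simp] = in_N_Obj[OF X]
  have "is_kernel C (Ident C X) (Zero C X X)"
    by (rule is_kernelI) (auto intro!: monicI)
  then show "X \<in> kernels_in C N" using kernels_inI[of C "Ident C X" "Zero C X X"] X by simp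
qed

text \<open>Let \<open>F = Dom q\<close> be the middle object of the blended extension of \<open>m \<cdot> e\<close>. The square formed by
  \<open>j\<close>, \<open>e\<close>, \<open>q\<close> and \<open>m\<close> is both a pushout and a pullback, that is, \<open>Dom e \<longrightarrow> F \<oplus> Cod e \<longrightarrow> Cod m\<close> is a short
  exact sequence. Its ends lie in \<open>N\<close>, hence so does the biproduct. Now \<open>Cod e\<close> is the cokernel of the
  inclusion of \<open>F\<close>, which is an arrow of \<open>N\<close>.\<close>

lemma image_in_N:
  assumes e: "epic C e" and m: "monic C m" and [simp]: "Dom C m = Cod C e"
    and N: "Dom C e \<in> N" "Cod C m \<in> N"
  shows "Cod C e \<in> N"
proof -
  note [simp] = epic_Arr[OF e] monic_Arr[OF m]
  obtain a where a: "is_kernel C a e" using ex_kernel[of e] by auto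
  obtain c where c: "is_cokernel C c m" using ex_cokernel[of m] by auto
  note [simp] = is_kernel_Arr[OF a] is_cokernel_Arr[OF c]
  obtain j q where [simp]: "j \<in> Arr C" "q \<in> Arr C" "Dom C j = Cod C a" "Cod C j = Dom C q" "Cod C q = Dom C c"
    and qj: "q \<cdot> j = m \<cdot> e" and s1: "ses C (j \<cdot> a) q" and s2: "ses C j (c \<cdot> q)"
    using ex_blended[OF kernel_of_Comp_monic[OF a m \<open>Dom C m = Cod C e\<close>]
        cokernel_of_Comp_epic[OF c e \<open>Dom C m = Cod C e\<close>[symmetric]]]
    unfolding blended_def by blast
  have mj: "monic C j" and q: "is_cokernel C q (j \<cdot> a)"
    using s1 s2 kernel_monic by (auto simp: ses_def)
  have "Cod C c \<in> N" using cokernel_in_N[OF cokernel_of_Comp_epic[OF c e]] N by simp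
  then have F: "Dom C q \<in> N" using extension_in_N[OF s2] N by simp
  obtain S i1 i2 p1 p2 where [simp]: "S \<in> Obj C" "i1 \<in> Arr C" "i2 \<in> Arr C" "p1 \<in> Arr C" "p2 \<in> Arr C"
    "Dom C i1 = Dom C q" "Cod C i1 = S" "Dom C i2 = Cod C e" "Cod C i2 = S"
    "Dom C p1 = S" "Cod C p1 = Dom C q" "Dom C p2 = S" "Cod C p2 = Cod C e" and
    pi: "p1 \<cdot> i1 = Ident C (Dom C q)" "p2 \<cdot> i2 = Ident C (Cod C e)"
    "p1 \<cdot> i2 = Zero C (Cod C e) (Dom C q)" "p2 \<cdot> i1 = Zero C (Dom C q) (Cod C e)" and
    sum: "(i1 \<cdot> p1) \<oplus> (i2 \<cdot> p2) = Ident C S"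
    using biproductE[OF Dom_Obj[OF \<open>q \<in> Arr C\<close>] Cod_Obj[OF epic_Arr[OF e]]] by blast
  define s where "s = (i1 \<cdot> j) \<oplus> (i2 \<cdot> e)"
  define t where "t = (q \<cdot> p1) \<oplus> neg C (m \<cdot> p2)"
  have [simp]: "s \<in> Arr C" "Dom C s = Dom C e" "Cod C s = S"
    "t \<in> Arr C" "Dom C t = S" "Cod C t = Cod C m"
    by (auto simp: s_def t_def)
  have p1s: "p1 \<cdot> s = j" and p2s: "p2 \<cdot> s = e" unfolding s_def
    by (subst distrib_left; auto simp: reassoc[OF pi(1)] reassoc[OF pi(2)] reassoc[OF pi(3)] reassoc[OF pi(4)])+
  have ti1: "t \<cdot> i1 = q" and ti2: "t \<cdot> i2 = neg C m" unfolding t_def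
    by (subst distrib_right; auto simp: assoc pi)+
  have "ses C s t"
  proof (rule ses_cokernelI)
    show "monic C s"
    proof (rule monicI)
      fix x assume [simp]: "x \<in> Arr C" "Cod C x = Dom C s" and x: "s \<cdot> x = Zero C (Dom C x) (Cod C s)"
      have "j \<cdot> x = p1 \<cdot> (s \<cdot> x)" by (subst reassoc[OF p1s]) auto
      then show "x = Zero C (Dom C x) (Dom C s)" using monicD[OF mj, of x] x by simp
    qed simp
    show "is_cokernel C t s"
    proof (rule is_cokernelI)
      show "epic C t"
        unfolding epic_def
      proof (intro conjI allI ballI impI)
        fix W x y assume "x \<in> homs C (Cod C t) W" "y \<in> homs C (Cod C t) W" and xy: "x \<cdot> t = y \<cdot> t"
        then have [simp]: "x \<in> Arr C" "y \<in> Arr C" "Dom C x = Cod C m" "Dom C y = Cod C m"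
          and [simp]: "Cod C x = W" "Cod C y = W" by (auto simp: homs_iff)
        have "x \<cdot> q = (x \<cdot> t) \<cdot> i1" by (simp add: assoc ti1)
        also have "\<dots> = y \<cdot> q" unfolding xy by (simp add: assoc ti1)
        finally show "x = y" using epic_cancel[OF cokernel_epic[OF q], of x y] by simp
      qed simp
      have "t \<cdot> s = (q \<cdot> j) \<oplus> neg C (m \<cdot> e)"
        unfolding t_def by (subst distrib_right) (auto simp: assoc p1s p2s)
      then show "t \<cdot> s = Zero C (Dom C s) (Cod C t)" by (simp add: qj)
      fix z assume [simp]: "z \<in> Arr C" "Dom C z = Cod C s" and z: "z \<cdot> s = Zero C (Dom C s) (Cod C z)"
      have "((z \<cdot> i1) \<cdot> j) \<oplus> ((z \<cdot> i2) \<cdot> e) = z \<cdot> s"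
        unfolding s_def by (subst distrib_left) (auto simp: assoc)
      then have zje: "(z \<cdot> i1) \<cdot> j = neg C ((z \<cdot> i2) \<cdot> e)"
        by (intro eq_negI) (auto simp: z)
      have "(z \<cdot> i1) \<cdot> (j \<cdot> a) = neg C ((z \<cdot> i2) \<cdot> (e \<cdot> a))"
        by (subst reassoc[OF zje]) (auto simp: assoc)
      then have "(z \<cdot> i1) \<cdot> (j \<cdot> a) = Zero C (Dom C (j \<cdot> a)) (Cod C (z \<cdot> i1))" by simp
      then obtain u where [simp]: "u \<in> Arr C" "Cod C u = Cod C z" "Dom C u = Cod C m"
        and u: "u \<cdot> q = z \<cdot> i1" using is_cokernelE[OF q, of "z \<cdot> i1"] by auto
      have "(u \<cdot> m) \<cdot> e = (u \<cdot> q) \<cdot> j" by (simp add: assoc qj)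
      also have "\<dots> = neg C (z \<cdot> i2) \<cdot> e" unfolding u zje by simp
      finally have um: "u \<cdot> m = neg C (z \<cdot> i2)"
        using epic_cancel[OF e, of "u \<cdot> m" "neg C (z \<cdot> i2)"] by simp
      have "u \<cdot> t = ((u \<cdot> q) \<cdot> p1) \<oplus> neg C ((u \<cdot> m) \<cdot> p2)"
        unfolding t_def by (subst distrib_left) (auto simp: assoc)
      also have "\<dots> = z \<cdot> ((i1 \<cdot> p1) \<oplus> (i2 \<cdot> p2))"
        unfolding u um by (subst distrib_left) (auto simp: assoc)
      finally have "u \<cdot> t = z" by (simp add: sum)
      then show "\<exists>u \<in> Arr C. Cod C u = Cod C z \<and> Dom C u = Cod C t \<and> u \<cdot> t = z"
        by (intro bexI[of _ u]) auto
    qed auto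
  qed
  then have "S \<in> N" using extension_in_N[of s t] N by simp
  moreover have "is_cokernel C p2 i1"
  proof (rule is_cokernelI)
    show "epic C p2"
      unfolding epic_def
    proof (intro conjI allI ballI impI)
      fix W x y assume "x \<in> homs C (Cod C p2) W" "y \<in> homs C (Cod C p2) W" and xy: "x \<cdot> p2 = y \<cdot> p2"
      then have [simp]: "x \<in> Arr C" "y \<in> Arr C" "Dom C x = Cod C e" "Dom C y = Cod C e"
        by (auto simp: homs_iff)
      have "x = (x \<cdot> p2) \<cdot> i2" by (simp add: assoc pi)
      also have "\<dots> = y" unfolding xy by (simp add: assoc pi)
      finally show "x = y" .
    qed simp
    fix x assume [simp]: "x \<in> Arr C" "Dom C x = Cod C i1" and x: "x \<cdot> i1 = Zero C (Dom C i1) (Cod C x)"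
    have "x \<cdot> ((i1 \<cdot> p1) \<oplus> (i2 \<cdot> p2)) = (x \<cdot> i2) \<cdot> p2"
      by (subst distrib_left) (auto simp: reassoc[OF x] assoc)
    then have "(x \<cdot> i2) \<cdot> p2 = x" by (simp add: sum)
    then show "\<exists>u \<in> Arr C. Cod C u = Cod C x \<and> Dom C u = Cod C p2 \<and> u \<cdot> p2 = x"
      by (intro bexI[of _ "x \<cdot> i2"]) auto
  qed (auto simp: pi)
  ultimately show ?thesis using cokernel_in_N[of p2 i1] F by simp
qed

text \<open>Let \<open>0 \<longrightarrow> X \<longrightarrow> Y \<longrightarrow> Z \<longrightarrow> 0\<close> be the sequence. Replacing \<open>X\<close> by an object \<open>M\<close> of \<open>N\<close> containing it with
  quotient in \<open>N\<close> enlarges \<open>Y\<close>, by a pushout, to an extension of \<open>Z\<close> by \<open>M\<close>. A blended extension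
  enlarges it further to an extension of an object of \<open>N\<close> containing \<open>Z\<close>, which lies in \<open>N\<close>. The two
  successive quotients lie in \<open>N\<close>, and hence so does the quotient by \<open>Y\<close>.\<close>

lemma kernels_closed_under_extensions:
  assumes s: "ses C i p" and X: "Dom C i \<in> kernels_in C N" and Z: "Cod C p \<in> kernels_in C N"
  shows "Cod C i \<in> kernels_in C N"
proof -
  have i: "monic C i" and pi: "is_cokernel C p i" using s kernel_monic by (auto simp: ses_def)
  note [simp] = is_cokernel_Arr[OF pi]
  obtain m n where mn: "ses C m n" "Dom C m = Dom C i" and Nm: "Cod C m \<in> N" "Cod C n \<in> N"
    using resolution[OF X] by blast
  have m: "monic C m" and nm: "is_cokernel C n m" using mn kernel_monic by (auto simp: ses_def)
  note [simp] = is_cokernel_Arr[OF nm]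
  have "Dom C i = Dom C m" using mn by simp
  then obtain g h where po: "is_pushout C m i g h" and h: "monic C h" and g: "monic C g"
    using ex_pushout_of_monics[OF m i] by blast
  note [simp] = pushout_Arr[OF po]
  obtain w where w: "Cod C w = Cod C n" "is_cokernel C w h"
    using pushout_cokernel[OF po nm] by blast
  obtain v where v: "Cod C v = Cod C p" "is_cokernel C v g"
    using pushout_cokernel[OF pushout_sym[OF po] pi] by blast
  obtain z c where zc: "ses C z c" "Dom C z = Cod C p" and Nz: "Cod C z \<in> N" "Cod C c \<in> N"
    using resolution[OF Z] by blast
  have z: "monic C z" and cz: "is_cokernel C c z" using zc kernel_monic by (auto simp: ses_def)
  note [simp] = is_cokernel_Arr[OF v(2)] is_cokernel_Arr[OF cz]
  have k: "is_kernel C g (z \<cdot> v)"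
    using kernel_of_Comp_monic[OF monic_kernel_of_cokernel[OF g v(2)] z] v(1) zc(2) by simp
  have c: "is_cokernel C c (z \<cdot> v)"
    using cokernel_of_Comp_epic[OF cz cokernel_epic[OF v(2)]] v(1) zc(2) by simp
  obtain j q where [simp]: "j \<in> Arr C" "q \<in> Arr C" "Dom C j = Cod C g" "Cod C j = Dom C q" "Cod C q = Dom C c"
    and s1: "ses C (j \<cdot> g) q" and s2: "ses C j (c \<cdot> q)"
    using ex_blended[OF k c] unfolding blended_def by blast
  have F: "Cod C j \<in> N" using extension_in_N[OF s1] Nm Nz by simp
  have j: "monic C j" and cj: "is_cokernel C (c \<cdot> q) j" using s2 kernel_monic by (auto simp: ses_def)
  have "Cod C h = Dom C j" by simp
  then obtain m' d n' where d: "is_cokernel C d (j \<cdot> h)" and "ses C m' n'" "Dom C m' = Cod C w"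
    "Cod C m' = Cod C d" "Cod C n' = Cod C (c \<cdot> q)"
    using cokernel_of_Comp_sequence[OF j w(2) _ cj] by blast
  then have "Cod C d \<in> N" using extension_in_N[of m' n'] Nm Nz w by simp
  moreover have "is_kernel C (j \<cdot> h) d"
    by (rule monic_kernel_of_cokernel[OF monic_Comp[OF h j] d]) simp
  ultimately show ?thesis
    using kernels_inI[of C "j \<cdot> h" d N] F is_cokernel_Arr[OF d] by simp
qed

text \<open>The codomain \<open>Y\<close> may be enlarged to an object of \<open>N\<close> without changing the kernel. The pushout of
  \<open>f\<close> along an embedding \<open>m\<close> of \<open>X\<close> into \<open>N\<close> then is an arrow with the same kernel, and its codomain is
  an extension of two objects of \<open>N\<close>.\<close>

lemma kernels_closed_under_kernels:
  assumes k: "is_kernel C k f" and X: "Dom C f \<in> kernels_in C N" and Y: "Cod C f \<in> kernels_in C N"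
  shows "Dom C k \<in> kernels_in C N"
proof -
  note [simp] = is_kernel_Arr[OF k]
  obtain m n where mn: "ses C m n" "Dom C m = Dom C f" and Nm: "Cod C m \<in> N" "Cod C n \<in> N"
    using resolution[OF X] by blast
  have m: "monic C m" and nm: "is_cokernel C n m" using mn kernel_monic by (auto simp: ses_def)
  note [simp] = is_cokernel_Arr[OF nm]
  obtain y y' where y: "ses C y y'" "Dom C y = Cod C f" "Cod C y \<in> N"
    using resolution[OF Y] by blast
  then have my: "monic C y" using kernel_monic by (auto simp: ses_def)
  note [simp] = monic_Arr[OF my] y(2)
  have "y \<cdot> f \<in> Arr C" "Dom C (y \<cdot> f) = Dom C m" using mn by simp_all
  then obtain h g where po: "is_pushout C m (y \<cdot> f) h g" and g: "monic C g"
    and ker: "\<And>k. is_kernel C k (y \<cdot> f) \<Longrightarrow> is_kernel C (m \<cdot> k) h"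
    using ex_pushout_of_monic[OF m] by blast
  note [simp] = pushout_Arr[OF po]
  obtain w where w: "Cod C w = Cod C n" "is_cokernel C w g"
    using pushout_cokernel[OF po nm] by blast
  have "Cod C g \<in> N"
    using extension_in_N[OF ses_cokernelI[OF w(2) g]] w(1) Nm y by simp
  moreover have "is_kernel C (m \<cdot> k) h" by (rule ker[OF kernel_of_Comp_monic[OF k my]]) simp
  ultimately show ?thesis
    using kernels_inI[of C "m \<cdot> k" h N] Nm mn by simp
qed

text \<open>A pushout along an embedding of the domain into \<open>N\<close> changes neither the cokernel nor, by closure
  under extensions, the assumption on the codomain, so let \<open>h\<close> go from \<open>N\<close> to \<open>P\<close>. If \<open>r\<close> embeds \<open>P\<close> into
  \<open>N\<close>, then the cokernel of \<open>h\<close> is the kernel of the arrow from the cokernel of \<open>r \<cdot> h\<close> to the cokernel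
  of \<open>r\<close>, and these two cokernels lie in \<open>N\<close>.\<close>

lemma kernels_closed_under_cokernels:
  assumes c: "is_cokernel C c f" and X: "Dom C f \<in> kernels_in C N" and Y: "Cod C f \<in> kernels_in C N"
  shows "Cod C c \<in> kernels_in C N"
proof -
  note [simp] = is_cokernel_Arr[OF c]
  obtain m n where mn: "ses C m n" "Dom C m = Dom C f" and Nm: "Cod C m \<in> N" "Cod C n \<in> N"
    using resolution[OF X] by blast
  have m: "monic C m" and nm: "is_cokernel C n m" using mn kernel_monic by (auto simp: ses_def)
  note [simp] = is_cokernel_Arr[OF nm]
  have "f \<in> Arr C" "Dom C f = Dom C m" using mn by simp_all
  then obtain h g where po: "is_pushout C m f h g" and g: "monic C g"
    using ex_pushout_of_monic[OF m] by blast
  note [simp] = pushout_Arr[OF po]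
  obtain w where w: "Cod C w = Cod C n" "is_cokernel C w g"
    using pushout_cokernel[OF po nm] by blast
  have P: "Cod C h \<in> kernels_in C N"
    using kernels_closed_under_extensions[OF ses_cokernelI[OF w(2) g]] w(1) Nm Y N_subset_kernels by auto
  obtain d where d: "Cod C d = Cod C c" "is_cokernel C d h"
    using pushout_cokernel[OF pushout_sym[OF po] c] by blast
  obtain r s where rs: "ses C r s" "Dom C r = Cod C h" and Nr: "Cod C r \<in> N" "Cod C s \<in> N"
    using resolution[OF P] by blast
  have r: "monic C r" and sr: "is_cokernel C s r" using rs kernel_monic by (auto simp: ses_def)
  note [simp] = is_cokernel_Arr[OF sr] rs(2)
  have "Cod C h = Dom C r" by simp
  then obtain m' d' n' where d': "is_cokernel C d' (r \<cdot> h)" and ses: "ses C m' n'" "Dom C m' = Cod C d"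
    "Cod C m' = Cod C d'" "Cod C n' = Cod C s"
    using cokernel_of_Comp_sequence[OF r d(2) _ sr] by blast
  have "Cod C d' \<in> N" using cokernel_in_N[OF d'] Nm Nr by simp
  then show ?thesis
    using kernels_inI[of C m' n' N] ses d Nr is_cokernel_Arr[of C n' m'] by (simp add: ses_def)
qed

lemma wide_kernels_in: "wide C (kernels_in C N)"
  unfolding wide_def
proof (intro conjI)
  show "closed_under_kernels C (kernels_in C N)"
    unfolding closed_under_kernels_def using kernels_closed_under_kernels by (auto simp: homs_iff)
  show "closed_under_cokernels C (kernels_in C N)"
    unfolding closed_under_cokernels_def using kernels_closed_under_cokernels by (auto simp: homs_iff)
  show "closed_under_extensions C (kernels_in C N)"
    unfolding closed_under_extensions_def short_exact_iff_ses
    using kernels_closed_under_extensions by blast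
  show "subcategory C (kernels_in C N)"
    unfolding subcategory_def
  proof (intro conjI ballI allI impI)
    show "kernels_in C N \<subseteq> Obj C"
      by (auto simp: kernels_in_def dest: is_kernel_Arr(1))
    show "kernels_in C N \<noteq> {}" using N_subset_kernels subcategory by (auto simp: subcategory_def)
    fix X Y assume "X \<in> kernels_in C N" and iso: "isomorphic C X Y"
    then obtain k f where k: "is_kernel C k f" and N: "Dom C f \<in> N" "Cod C f \<in> N" and X: "Dom C k = X"
      by (auto simp: kernels_in_def)
    note [simp] = is_kernel_Arr[OF k]
    obtain s t where "s \<in> homs C X Y" "t \<in> homs C Y X" "t \<cdot> s = Ident C X" "s \<cdot> t = Ident C Y"
      using iso by (auto simp: isomorphic_def)
    then have [simp]: "s \<in> Arr C" "t \<in> Arr C" "Dom C s = Dom C k" "Cod C s = Dom C t"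
      "Dom C t = Y" "Cod C t = Dom C k" "t \<cdot> s = Ident C (Dom C k)" and st: "s \<cdot> t = Ident C Y"
      using X by (auto simp: homs_iff)
    have "monic C t"
    proof (rule monicI)
      fix x assume [simp]: "x \<in> Arr C" "Cod C x = Dom C t" and x: "t \<cdot> x = Zero C (Dom C x) (Cod C t)"
      have "x = s \<cdot> (t \<cdot> x)" by (subst reassoc[OF st]) auto
      then show "x = Zero C (Dom C x) (Dom C t)" unfolding x by simp
    qed simp
    have "is_kernel C (k \<cdot> t) f"
    proof (rule is_kernelI)
      show "monic C (k \<cdot> t)" by (rule monic_Comp[OF \<open>monic C t\<close> kernel_monic[OF k]]) simp
      have "f \<cdot> (k \<cdot> t) = Zero C (Dom C k) (Cod C f) \<cdot> t"
        by (rule reassoc) simp_all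
      then show "f \<cdot> (k \<cdot> t) = Zero C (Dom C (k \<cdot> t)) (Cod C f)" by simp
      fix x assume [simp]: "x \<in> Arr C" "Cod C x = Dom C f" and x: "f \<cdot> x = Zero C (Dom C x) (Cod C f)"
      then obtain u where [simp]: "u \<in> Arr C" "Dom C u = Dom C x" "Cod C u = Dom C k" and u: "k \<cdot> u = x"
        using is_kernelE[OF k, of x] by auto
      have "t \<cdot> (s \<cdot> u) = Ident C (Dom C k) \<cdot> u" by (rule reassoc) simp_all
      then have "k \<cdot> t \<cdot> (s \<cdot> u) = x" by (simp add: assoc u)
      then show "\<exists>u \<in> Arr C. Dom C u = Dom C x \<and> Cod C u = Dom C (k \<cdot> t) \<and> k \<cdot> t \<cdot> u = x"
        by (intro bexI[of _ "s \<cdot> u"]) simp_all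
    qed (use is_kernel_Arr[OF k] in simp_all)
    then show "Y \<in> kernels_in C N" using kernels_inI[of C "k \<cdot> t" f N] N by simp
  qed
qed

end

section \<open>Wide subcategories as abelian categories\<close>

lemma full_sub_simps [simp]:
  "Obj (full_sub C S) = S" "Dom (full_sub C S) = Dom C" "Cod (full_sub C S) = Cod C"
  "Ident (full_sub C S) = Ident C" "Comp (full_sub C S) = Comp C"
  "Plus (full_sub C S) = Plus C" "Zero (full_sub C S) = Zero C"
  by (simp_all add: full_sub_def)

lemma Arr_full_sub [simp]: "f \<in> Arr (full_sub C S) \<longleftrightarrow> f \<in> Arr C \<and> Dom C f \<in> S \<and> Cod C f \<in> S"
  by (simp add: full_sub_def)

lemma homs_full_sub [simp]:
  "f \<in> homs (full_sub C S) X Y \<longleftrightarrow> f \<in> homs C X Y \<and> X \<in> S \<and> Y \<in> S"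
  by (auto simp: homs_def)

lemma full_sub_opposite: "full_sub (opposite C) S = opposite (full_sub C S)"
  by (cases C) (auto simp: full_sub_def opposite_def)

lemma closed_under_kernels_opposite:
  "closed_under_kernels (opposite C) S \<longleftrightarrow> closed_under_cokernels C S"
  by (auto simp: closed_under_kernels_def closed_under_cokernels_def)

context abelian_category
begin

text \<open>A kernel in the full subcategory is only tested against arrows from objects of \<open>S\<close>. Since the
  kernel in the ambient category lies in \<open>S\<close>, each of the two factors through the other, and the
  former inherits the full universal property.\<close>

lemma is_kernel_full_sub:
  assumes S: "closed_under_kernels C S" and f: "f \<in> Arr (full_sub C S)"
  shows "is_kernel (full_sub C S) k f \<longleftrightarrow> is_kernel C k f"
proof
  assume k: "is_kernel C k f"
  then have "Dom C k \<in> S" using closed_under_kernelsD[OF S] f by simp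
  then show "is_kernel (full_sub C S) k f"
    using k f unfolding is_kernel_def by auto
next
  assume k: "is_kernel (full_sub C S) k f"
  obtain k' where k': "is_kernel C k' f" using ex_kernel[of f] f by auto
  note [simp] = is_kernel_Arr[OF k']
  have [simp]: "k \<in> Arr C" "Cod C k = Dom C f" "Dom C k \<in> S" "f \<cdot> k = Zero C (Dom C k) (Cod C f)"
    "Cod C f \<in> S" "Dom C f \<in> S"
    using is_kernel_Arr[OF k] f by simp_all
  have S': "Dom C k' \<in> S" using closed_under_kernelsD[OF S k'] by simp
  obtain u where [simp]: "u \<in> Arr C" "Dom C u = Dom C k" "Cod C u = Dom C k'" and u: "k' \<cdot> u = k"
    using is_kernelE[OF k', of k] by auto
  have "k' \<in> Arr (full_sub C S)" "Cod (full_sub C S) k' = Dom (full_sub C S) f"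
    "Comp (full_sub C S) f k' = Zero (full_sub C S) (Dom (full_sub C S) k') (Cod (full_sub C S) f)"
    using S' by simp_all
  then obtain v where "v \<in> Arr (full_sub C S)" "Dom (full_sub C S) v = Dom (full_sub C S) k'"
    "Cod (full_sub C S) v = Dom (full_sub C S) k" "Comp (full_sub C S) k v = k'"
    using is_kernelE[OF k] by blast
  then have [simp]: "v \<in> Arr C" "Dom C v = Dom C k'" "Cod C v = Dom C k" and v: "k \<cdot> v = k'"
    by simp_all
  have "k \<in> homs (full_sub C S) (Dom C k) (Dom C f)" by (simp add: homs_iff)
  then have "\<exists>!w. w \<in> homs (full_sub C S) (Dom C k) (Dom C k) \<and> k \<cdot> w = k"
    using k unfolding is_kernel_def by auto
  moreover have "k \<cdot> (v \<cdot> u) = k" by (subst reassoc[OF v]) (auto simp: u)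
  moreover have "k \<cdot> Ident C (Dom C k) = k" by simp
  moreover have "v \<cdot> u \<in> homs (full_sub C S) (Dom C k) (Dom C k)"
    "Ident C (Dom C k) \<in> homs (full_sub C S) (Dom C k) (Dom C k)" by (simp_all add: homs_iff)
  ultimately have vu: "v \<cdot> u = Ident C (Dom C k)" by blast
  show "is_kernel C k f"
  proof (rule is_kernelI)
    show "monic C k"
    proof (rule monicI)
      fix x assume [simp]: "x \<in> Arr C" "Cod C x = Dom C k" and x: "k \<cdot> x = Zero C (Dom C x) (Cod C k)"
      have "k' \<cdot> (u \<cdot> x) = Zero C (Dom C (u \<cdot> x)) (Cod C k')" by (subst reassoc[OF u]) (auto simp: x)
      then have "u \<cdot> x = Zero C (Dom C x) (Dom C k')"
        using monicD[OF kernel_monic[OF k'], of "u \<cdot> x"] by simp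
      moreover have "x = v \<cdot> (u \<cdot> x)" by (subst reassoc[OF vu]) auto
      ultimately show "x = Zero C (Dom C x) (Dom C k)" by simp
    qed simp
    fix x assume [simp]: "x \<in> Arr C" "Cod C x = Dom C f" and "f \<cdot> x = Zero C (Dom C x) (Cod C f)"
    then obtain y where [simp]: "y \<in> Arr C" "Dom C y = Dom C x" "Cod C y = Dom C k'" and y: "k' \<cdot> y = x"
      using is_kernelE[OF k', of x] by auto
    have "k \<cdot> (v \<cdot> y) = x" by (subst reassoc[OF v]) (auto simp: y)
    then show "\<exists>u \<in> Arr C. Dom C u = Dom C x \<and> Cod C u = Dom C k \<and> k \<cdot> u = x"
      by (intro bexI[of _ "v \<cdot> y"]) auto
  qed simp_all
qed

lemma is_cokernel_full_sub:
  assumes "closed_under_cokernels C S" "f \<in> Arr (full_sub C S)"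
  shows "is_cokernel (full_sub C S) c f \<longleftrightarrow> is_cokernel C c f"
  using abelian_category.is_kernel_full_sub[OF abelian_opposite, of S f c] assms
  by (simp add: full_sub_opposite closed_under_kernels_opposite)

text \<open>Cancellation against the kernel, which lies in \<open>S\<close>, already shows that the kernel is zero.\<close>

lemma monic_full_sub:
  assumes S: "closed_under_kernels C S" and f: "f \<in> Arr (full_sub C S)"
  shows "monic (full_sub C S) f \<longleftrightarrow> monic C f"
proof
  assume "monic C f"
  then show "monic (full_sub C S) f" using f unfolding monic_def by auto
next
  assume m: "monic (full_sub C S) f"
  have [simp]: "f \<in> Arr C" "Dom C f \<in> S" "Cod C f \<in> S" using f by auto
  obtain k where k: "is_kernel C k f" using ex_kernel[of f] by auto
  note [simp] = is_kernel_Arr[OF k]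
  have [simp]: "Dom C k \<in> S" using closed_under_kernelsD[OF S k] by simp
  have "k \<in> homs (full_sub C S) (Dom C k) (Dom C f)"
    "Zero C (Dom C k) (Dom C f) \<in> homs (full_sub C S) (Dom C k) (Dom C f)" by (simp_all add: homs_iff)
  moreover have "f \<cdot> k = f \<cdot> Zero C (Dom C k) (Dom C f)" by simp
  ultimately have k0: "k = Zero C (Dom C k) (Dom C f)"
    using m unfolding monic_def full_sub_simps by blast
  show "monic C f"
  proof (rule monicI)
    fix x assume [simp]: "x \<in> Arr C" "Cod C x = Dom C f" and "f \<cdot> x = Zero C (Dom C x) (Cod C f)"
    then obtain u where [simp]: "u \<in> Arr C" "Dom C u = Dom C x" "Cod C u = Dom C k" and u: "k \<cdot> u = x"
      using is_kernelE[OF k, of x] by auto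
    have "k \<cdot> u = Zero C (Dom C x) (Dom C f)" by (subst k0) simp
    then show "x = Zero C (Dom C x) (Dom C f)" using u by simp
  qed simp
qed

lemma epic_full_sub:
  assumes "closed_under_cokernels C S" "f \<in> Arr (full_sub C S)"
  shows "epic (full_sub C S) f \<longleftrightarrow> epic C f"
  using abelian_category.monic_full_sub[OF abelian_opposite, of S f] assms
  by (simp add: full_sub_opposite closed_under_kernels_opposite)

lemma short_exact_full_sub:
  assumes K: "closed_under_kernels C S" and Q: "closed_under_cokernels C S"
    and i: "i \<in> Arr (full_sub C S)" and p: "p \<in> Arr (full_sub C S)"
  shows "short_exact (full_sub C S) i p \<longleftrightarrow> short_exact C i p"
proof -
  have "is_image (full_sub C S) m i \<longleftrightarrow> is_image C m i" for m
  proof -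
    have "is_cokernel (full_sub C S) c i \<and> is_kernel (full_sub C S) m c \<longleftrightarrow>
        is_cokernel C c i \<and> is_kernel C m c" for c
    proof (cases "is_cokernel C c i")
      case True
      then have "c \<in> Arr (full_sub C S)"
        using closed_under_cokernelsD[OF Q True] is_cokernel_Arr[OF True] i by simp
      then show ?thesis using is_cokernel_full_sub[OF Q i] is_kernel_full_sub[OF K] by blast
    qed (use is_cokernel_full_sub[OF Q i] in blast)
    then show ?thesis unfolding is_image_def by blast
  qed
  then have "exact_pair (full_sub C S) i p \<longleftrightarrow> exact_pair C i p"
    using i p is_kernel_full_sub[OF K p] unfolding exact_pair_def by auto
  then show ?thesis
    using monic_full_sub[OF K i] epic_full_sub[OF Q p] unfolding short_exact_def by blast
qed

lemma wide_Obj: "wide C (Obj C)"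
proof -
  obtain Z where "Z \<in> Obj C" using ex_zero_object by (auto simp: zero_object_def)
  then show ?thesis
    unfolding wide_def subcategory_def closed_under_kernels_def closed_under_cokernels_def
      closed_under_extensions_def
    by (auto simp: isomorphic_def is_kernel_def is_cokernel_def short_exact_def monic_def)
qed

text \<open>The whole category is wide, so that the intersection is taken over a nonempty family.\<close>

lemma wide_wide_closure:
  assumes "subcategory C N"
  shows "wide C (wide_closure C N)"
proof -
  let ?F = "{W. wide C W \<and> N \<subseteq> W}"
  have "Obj C \<in> ?F" using wide_Obj assms by (auto simp: subcategory_def)
  moreover have "N \<subseteq> \<Inter> ?F" by blast
  ultimately have "subcategory C (\<Inter> ?F)"
    using assms unfolding subcategory_def wide_def by blast
  moreover have "closed_under_kernels C (\<Inter> ?F)"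
    unfolding closed_under_kernels_def wide_def by blast
  moreover have "closed_under_cokernels C (\<Inter> ?F)"
    unfolding closed_under_cokernels_def wide_def by blast
  moreover have "closed_under_extensions C (\<Inter> ?F)"
    unfolding closed_under_extensions_def wide_def by blast
  ultimately show ?thesis unfolding wide_closure_def wide_def by blast
qed

lemma subset_wide_closure: "N \<subseteq> wide_closure C N"
  by (auto simp: wide_closure_def)

end

section \<open>Narrow subcategories and tilting nullity classes\<close>

lemma (in abelian_category) narrow_if_nullity_class:
  assumes N: "subcategory C N" and W: "wide C W" and NW: "N \<subseteq> W"
    and null: "nullity_class (full_sub C W) N"
  shows "narrow C N"
  unfolding narrow_def
proof (intro conjI)
  have K: "closed_under_kernels C W" and Q: "closed_under_cokernels C W"
    and E: "closed_under_extensions C W" using W by (auto simp: wide_def)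
  show "subcategory C N" by (rule N)
  show "closed_under_extensions C N"
    unfolding closed_under_extensions_def
  proof (intro allI impI)
    fix i p assume s: "short_exact C i p \<and> Dom C i \<in> N \<and> Cod C p \<in> N"
    then have "Cod C i \<in> W" using E NW unfolding closed_under_extensions_def by blast
    then have "i \<in> Arr (full_sub C W)" "p \<in> Arr (full_sub C W)"
      using s NW unfolding short_exact_def exact_pair_def by auto
    then have "short_exact (full_sub C W) i p" using short_exact_full_sub[OF K Q] s by blast
    then show "Cod C i \<in> N"
      using null s unfolding nullity_class_def closed_under_extensions_def full_sub_simps by blast
  qed
  show "closed_under_cokernels C N"
    unfolding closed_under_cokernels_def
  proof (intro ballI allI impI)
    fix X Y f c assume XY: "X \<in> N" "Y \<in> N" "f \<in> homs C X Y" and c: "is_cokernel C c f"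
    then have "c \<in> Arr (full_sub C W)"
      using closed_under_cokernelsD[OF Q c] is_cokernel_Arr[OF c] NW by (auto simp: homs_iff)
    then have "epic (full_sub C W) c" using epic_full_sub[OF Q] cokernel_epic[OF c] by blast
    moreover have "Dom C c \<in> N" using XY is_cokernel_Arr(3)[OF c] by (simp add: homs_iff)
    ultimately show "Cod C c \<in> N"
      using null unfolding nullity_class_def closed_under_quotients_def by simp
  qed
qed

text \<open>All that matters about the ambient wide subcategory is that its objects are kernels of arrows of
  \<open>N\<close>: by \<open>resolution\<close> they embed into \<open>N\<close>, and a quotient of an object of \<open>N\<close> that embeds into \<open>N\<close> is
  the image of an arrow of \<open>N\<close>.\<close>

lemma (in hereditary_narrow) tilting_nullity_class:
  assumes W: "wide C W" and NW: "N \<subseteq> W" and WK: "W \<subseteq> kernels_in C N"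
  shows "nullity_class (full_sub C W) N" "tilting (full_sub C W) N"
proof -
  have K: "closed_under_kernels C W" and Q: "closed_under_cokernels C W"
    using W by (auto simp: wide_def)
  have embed: "\<exists>m. monic C m \<and> Dom C m = X \<and> Cod C m \<in> N" if "X \<in> W" for X
  proof -
    have "X \<in> kernels_in C N" using that WK by blast
    then obtain m n where "ses C m n" "Dom C m = X" "Cod C m \<in> N" using resolution by blast
    then show ?thesis using kernel_monic by (auto simp: ses_def)
  qed
  show "tilting (full_sub C W) N"
    unfolding tilting_def
  proof
    fix X assume "X \<in> Obj (full_sub C W)"
    then have X: "X \<in> W" by simp
    then obtain m where m: "monic C m" "Dom C m = X" "Cod C m \<in> N" using embed by blast
    then have "m \<in> Arr (full_sub C W)" using X NW monic_Arr by auto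
    then show "\<exists>f. monic (full_sub C W) f \<and> Dom (full_sub C W) f = X \<and> Cod (full_sub C W) f \<in> N"
      using monic_full_sub[OF K] m by (intro exI[of _ m]) simp
  qed
  show "nullity_class (full_sub C W) N"
    unfolding nullity_class_def
  proof (intro conjI)
    have "isomorphic C X Y" if iso: "isomorphic (full_sub C W) X Y" and X: "X \<in> N" for X Y
    proof -
      obtain f g where "f \<in> homs (full_sub C W) X Y" "g \<in> homs (full_sub C W) Y X"
        "g \<cdot> f = Ident C X" "f \<cdot> g = Ident C Y" and "Y \<in> W"
        using iso unfolding isomorphic_def full_sub_simps by blast
      moreover from \<open>Y \<in> W\<close> have "Y \<in> Obj C" using W by (auto simp: wide_def subcategory_def)
      ultimately show ?thesis using in_N_Obj[OF X] unfolding isomorphic_def homs_full_sub by blast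
    qed
    then show "subcategory (full_sub C W) N"
      using subcategory NW unfolding subcategory_def full_sub_simps by blast
    show "closed_under_quotients (full_sub C W) N"
      unfolding closed_under_quotients_def
    proof (intro allI impI)
      fix p assume p: "epic (full_sub C W) p \<and> Dom (full_sub C W) p \<in> N"
      then have a: "p \<in> Arr (full_sub C W)" by (simp add: epic_def)
      then have e: "epic C p" using epic_full_sub[OF Q] p by blast
      obtain m where "monic C m" "Dom C m = Cod C p" "Cod C m \<in> N"
        using embed[of "Cod C p"] a by auto
      then show "Cod (full_sub C W) p \<in> N" using image_in_N[OF e] p by simp
    qed
    show "closed_under_extensions (full_sub C W) N"
      unfolding closed_under_extensions_def
    proof (intro allI impI)
      fix i p
      assume s: "short_exact (full_sub C W) i p \<and> Dom (full_sub C W) i \<in> N \<and> Cod (full_sub C W) p \<in> N"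
      then have "i \<in> Arr (full_sub C W)" "p \<in> Arr (full_sub C W)"
        unfolding short_exact_def exact_pair_def by blast+
      then have "short_exact C i p" using short_exact_full_sub[OF K Q] s by blast
      then show "Cod (full_sub C W) i \<in> N"
        using s extensions unfolding closed_under_extensions_def full_sub_simps by blast
    qed
  qed
qed

theorem corollary3p5:
  fixes A :: "('o, 'm) ab_cat" and N :: "'o set"
  assumes "hereditary_abelian_category A"
    and "subcategory A N"
  shows "narrow A N \<longleftrightarrow>
    nullity_class (full_sub A (wide_closure A N)) N \<and> tilting (full_sub A (wide_closure A N)) N"
proof -
  interpret hereditary_abelian_category A by (rule assms(1))
  note W = wide_wide_closure[OF assms(2)] subset_wide_closure
  show ?thesis
  proof
    assume "narrow A N"
    then interpret hereditary_narrow A N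
      by unfold_locales (auto simp: narrow_def)
    have "wide_closure A N \<subseteq> kernels_in A N"
      using wide_kernels_in N_subset_kernels unfolding wide_closure_def by blast
    then show "nullity_class (full_sub A (wide_closure A N)) N \<and> tilting (full_sub A (wide_closure A N)) N"
      using tilting_nullity_class[OF W] by blast
  next
    assume "nullity_class (full_sub A (wide_closure A N)) N \<and> tilting (full_sub A (wide_closure A N)) N"
    then show "narrow A N" using narrow_if_nullity_class[OF assms(2) W] by blast
  qed
qed

end
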